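(* For each $n$ let $s=s_n\ge1$, $m=m_n>0$, $\mu=\mu_n>0$, and let $\mathcal{C}'$ denote the class of all subsets of $\{1,\ldots,n\}$ with cardinality $s$, $s+1$ or $s-1$. Assume $s=o(n)$ as $n\to\infty$. Let $\hat S_n$ be an arbitrary adaptive sensing estimation procedure (a sensing strategy with total budget $m$ together with a support estimator based on the resulting data) for which $$\lim_{n\to\infty}\max_{S\in\mathcal{C}'}\mathbb{E}_S\bigl[d(\hat S_n,S)\bigr]=0.$$ Then necessarily there is a sequence $\omega_n$ with $\lim_{n\to\infty}\omega_n=\infty$ such that the signal magnitude $x_{\min}=\mu$ satisfies $$x_{\min}\ \ge\ \sqrt{2\,\frac{n}{m}\,(\log s+\omega_n)}.$$
   Context: Signal model: for $S\subseteq\{1,\ldots,n\}$ the signal $\vec{x}\in\mathbb{R}^n$ with support $S$ is given by $x_i=\mu$ if $i\in S$ and $x_i=0$ otherwise; for $S\neq\emptyset$, $x_{\min}=\min\{|x_i|:x_i\neq0\}=\mu$. Adaptive sensing: one observes $Y_k=x_{A_k}+\Gamma_k^{-1}W_k$, $k=1,2,\ldots$, where $A_k\in\{1,\ldots,n\}$ is the entry measured at time $k$ and $\Gamma_k^2$ is the precision of that measurement. The pair $(A_k,\Gamma_k)$ is chosen as a (possibly randomized) function of the past $\{Y_i,A_i,\Gamma_i\}_{i=1}^{k-1}$; the $W_k$ are standard normal, each $W_k$ being independent of $\{Y_i\}_{i=1}^{k-1}$, $\{A_i,\Gamma_i\}_{i=1}^{k}$ (and of any extra randomization). The sensing strategy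 is the collection of conditional distributions of $(A_k,\Gamma_k)$ given $\{Y_i,A_i,\Gamma_i\}_{i=1}^{k-1}$, for all $k$; it does not depend on the unknown $S$. The budget constraint is $\sum_{k=1}^\infty\Gamma_k^2\le m$ (almost surely). Convention: $\Gamma_k=0$ is allowed and means that no (informative) measurement is made at step $k$. $\mathbb{E}_S$ denotes expectation when the support is $S$. An estimator is a measurable function of $D=\{Y_i,A_i,\Gamma_i\}_{i=1}^\infty$ with values in the subsets of $\{1,\ldots,n\}$, and $d(\hat S,S)=|\hat S\,\Delta\,S|$ is the cardinality of the symmetric difference. If the quantity under the square root is negative (which can happen only for finitely many $n$), the lower bound is understood to be vacuous. *)

theory Defs
  imports "HOL-Probability.Probability" "HOL-Library.Landau_Symbols"
begin

section \<open>Signals\<close>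

definition signal :: "real \<Rightarrow> nat set \<Rightarrow> nat \<Rightarrow> real" where
  "signal \<mu> S i = (if i \<in> S then \<mu> else 0)"

definition x_min :: "nat \<Rightarrow> (nat \<Rightarrow> real) \<Rightarrow> real" where
  "x_min n x = Min {\<bar>x i\<bar> | i. i \<in> {1..n} \<and> x i \<noteq> 0}"

lemma x_min_signal:
  assumes "\<mu> > 0" "S \<subseteq> {1..n}" "S \<noteq> {}"
  shows "x_min n (signal \<mu> S) = \<mu>"
proof -
  have "{i. i \<in> {1..n} \<and> signal \<mu> S i \<noteq> 0} = S"
    using assms by (auto simp: signal_def)
  moreover have "{\<bar>signal \<mu> S i\<bar> | i. i \<in> {1..n} \<and> signal \<mu> S i \<noteq> 0}
      = (\<lambda>i. \<bar>signal \<mu> S i\<bar>) ` {i. i \<in> {1..n} \<and> signal \<mu> S i \<noteq> 0}"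
    by blast
  moreover have "(\<lambda>i. \<bar>signal \<mu> S i\<bar>) ` S = {\<mu>}"
    using assms by (auto simp: signal_def image_def)
  ultimately have "{\<bar>signal \<mu> S i\<bar> | i. i \<in> {1..n} \<and> signal \<mu> S i \<noteq> 0} = {\<mu>}"
    by simp
  then show ?thesis by (simp add: x_min_def)
qed

section \<open>Adaptive sensing\<close>

text \<open>
  A measurement action is a pair \<open>(A, \<Gamma>)\<close> and an observation a triple \<open>(Y, A, \<Gamma>)\<close>.
  Time is indexed from 0. A history before time \<open>k\<close> is a point of the product of
  \<open>obs_space n\<close> over \<open>{0..<k}\<close>, the complete data \<open>D\<close> a point of \<open>data_space n\<close>.
\<close>

type_synonym action = "nat \<times> real"
type_synonym obs = "real \<times> action"
type_synonym strategy = "nat \<Rightarrow> (nat \<Rightarrow> obs) \<Rightarrow> action measure"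

definition action_space :: "nat \<Rightarrow> action measure" where
  "action_space n = count_space {1..n} \<Otimes>\<^sub>M borel"

definition obs_space :: "nat \<Rightarrow> obs measure" where
  "obs_space n = borel \<Otimes>\<^sub>M action_space n"

definition history_space :: "nat \<Rightarrow> nat \<Rightarrow> (nat \<Rightarrow> obs) measure" where
  "history_space n k = PiM {0..<k} (\<lambda>_. obs_space n)"

definition data_space :: "nat \<Rightarrow> (nat \<Rightarrow> obs) measure" where
  "data_space n = PiM UNIV (\<lambda>_. obs_space n)"

text \<open>\<open>Q k\<close> is the conditional distribution of \<open>(A\<^sub>k, \<Gamma>\<^sub>k)\<close> given the past; it does not
  involve the signal. Randomized choices are allowed since \<open>Q k h\<close> is an arbitrary
  probability measure.\<close>

definition sensing_strategy :: "nat \<Rightarrow> strategy \<Rightarrow> bool" where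
  "sensing_strategy n Q \<longleftrightarrow>
     (\<forall>k. Q k \<in> history_space n k \<rightarrow>\<^sub>M prob_algebra (action_space n))"

text \<open>
  The observation \<open>x\<^sub>A + \<Gamma>\<^sup>-\<^sup>1 W\<close>, together with the action. For \<open>\<Gamma> = 0\<close> no measurement
  is made and the constant 0 is recorded; without the case distinction the convention
  \<open>w / 0 = 0\<close> would reveal \<open>x\<^sub>A\<close> exactly.
\<close>

definition observe :: "(nat \<Rightarrow> real) \<Rightarrow> action \<Rightarrow> real \<Rightarrow> obs" where
  "observe x = (\<lambda>(a, g) w. (if g = 0 then 0 else x a + w / g, (a, g)))"

text \<open>The conditional law of \<open>(Y\<^sub>k, A\<^sub>k, \<Gamma>\<^sub>k)\<close> given the past: draw the action from \<open>Q k\<close>,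
  then \<open>W\<^sub>k\<close> independently of the past and of the action.\<close>

definition obs_kernel :: "nat \<Rightarrow> (nat \<Rightarrow> real) \<Rightarrow> strategy \<Rightarrow> nat \<Rightarrow> (nat \<Rightarrow> obs) \<Rightarrow> obs measure"
  where "obs_kernel n x Q k h =
    distr (Q k h \<Otimes>\<^sub>M std_normal_distribution) (obs_space n) (\<lambda>(b, w). observe x b w)"

text \<open>The law of the complete data, from the theorem of Ionescu-Tulcea. It is only
  meaningful when \<open>sensing_strategy n Q\<close> holds.\<close>

definition data_law :: "nat \<Rightarrow> (nat \<Rightarrow> real) \<Rightarrow> strategy \<Rightarrow> (nat \<Rightarrow> obs) measure" where
  "data_law n x Q =
     projective_family.lim UNIV
       (Ionescu_Tulcea.CI (obs_kernel n x Q) (\<lambda>_. obs_space n)) (\<lambda>_. obs_space n)"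

text \<open>The sum is taken in the extended nonnegative reals, so a divergent sum
  violates the budget.\<close>

definition within_budget :: "nat \<Rightarrow> real \<Rightarrow> real \<Rightarrow> strategy \<Rightarrow> bool" where
  "within_budget n m \<mu> Q \<longleftrightarrow>
     (\<forall>S \<subseteq> {1..n}. AE D in data_law n (signal \<mu> S) Q.
        (\<Sum>k. ennreal ((snd (snd (D k)))\<^sup>2)) \<le> ennreal m)"

lemma Ionescu_Tulcea_obs_kernel:
  assumes "sensing_strategy n Q"
  shows "Ionescu_Tulcea (obs_kernel n x Q) (\<lambda>_. obs_space n)"
proof (rule Ionescu_Tulcea.intro)
  have Q: "Q k \<in> PiM {0..<k} (\<lambda>_. obs_space n) \<rightarrow>\<^sub>M prob_algebra (action_space n)" for k
    using assms by (simp add: sensing_strategy_def history_space_def)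
  have x: "x \<in> count_space {1..n} \<rightarrow>\<^sub>M borel" by simp
  have obs: "(\<lambda>(b, w). observe x b w)
      \<in> action_space n \<Otimes>\<^sub>M std_normal_distribution \<rightarrow>\<^sub>M obs_space n"
    unfolding observe_def obs_space_def action_space_def split_beta
    using x by measurable
  have N: "std_normal_distribution \<in> space (prob_algebra borel)"
    using real_dist_normal_dist
    by (auto simp: space_prob_algebra real_distribution_def)
  fix k
  have K: "obs_kernel n x Q k
      \<in> PiM {0..<k} (\<lambda>_. obs_space n) \<rightarrow>\<^sub>M prob_algebra (obs_space n)"
  proof -
    have pair: "(\<lambda>h. Q k h \<Otimes>\<^sub>M std_normal_distribution) \<in> PiM {0..<k} (\<lambda>_. obs_space n)
        \<rightarrow>\<^sub>M prob_algebra (action_space n \<Otimes>\<^sub>M borel)"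
      by (rule measurable_pair_prob[OF Q measurable_const[OF N]])
    show ?thesis
      unfolding obs_kernel_def[abs_def]
      by (rule measurable_distr_prob_space2[OF pair])
        (use obs in \<open>simp cong: measurable_cong_sets\<close>)
  qed
  show "obs_kernel n x Q k
      \<in> PiM {0..<k} (\<lambda>_. obs_space n) \<rightarrow>\<^sub>M subprob_algebra (obs_space n)"
    by (rule measurable_prob_algebraD[OF K])
  fix h assume "h \<in> space (PiM {0..<k} (\<lambda>_. obs_space n))"
  then show "prob_space (obs_kernel n x Q k h)"
    using measurable_space[OF K] by (auto simp: space_prob_algebra)
qed

lemma sets_data_law:
  assumes "sensing_strategy n Q"
  shows "sets (data_law n x Q) = sets (data_space n)"
proof -
  interpret Ionescu_Tulcea "obs_kernel n x Q" "\<lambda>_. obs_space n"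
    by (rule Ionescu_Tulcea_obs_kernel[OF assms])
  show ?thesis by (simp add: data_law_def data_space_def)
qed

lemma distr_data_law:
  assumes "sensing_strategy n Q"
  shows "distr (data_law n x Q) (history_space n k) (\<lambda>D. restrict D {0..<k}) =
    Ionescu_Tulcea.CI (obs_kernel n x Q) (\<lambda>_. obs_space n) {0..<k}"
proof -
  interpret Ionescu_Tulcea "obs_kernel n x Q" "\<lambda>_. obs_space n"
    by (rule Ionescu_Tulcea_obs_kernel[OF assms])
  show ?thesis by (simp add: data_law_def history_space_def distr_lim)
qed

lemma prob_space_data_law:
  assumes "sensing_strategy n Q"
  shows "prob_space (data_law n x Q)"
proof -
  interpret Ionescu_Tulcea "obs_kernel n x Q" "\<lambda>_. obs_space n"
    by (rule Ionescu_Tulcea_obs_kernel[OF assms])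
  have meas: "(\<lambda>D. restrict D {}) \<in> PF.lim \<rightarrow>\<^sub>M PiM {} (\<lambda>_. obs_space n)"
    by (simp add: measurable_restrict_subset cong: measurable_cong_sets)
  have "prob_space (distr PF.lim (PiM {} (\<lambda>_. obs_space n)) (\<lambda>D. restrict D {}))"
    using PF.prob_space_P[of "{}"] by (simp add: distr_lim)
  then show ?thesis
    unfolding data_law_def by (rule prob_space_distrD[OF meas])
qed

section \<open>Support estimation\<close>

definition support_estimator :: "nat \<Rightarrow> ((nat \<Rightarrow> obs) \<Rightarrow> nat set) \<Rightarrow> bool" where
  "support_estimator n \<phi> \<longleftrightarrow> \<phi> \<in> data_space n \<rightarrow>\<^sub>M count_space (Pow {1..n})"

definition expected_error ::
    "nat \<Rightarrow> real \<Rightarrow> strategy \<Rightarrow> ((nat \<Rightarrow> obs) \<Rightarrow> nat set) \<Rightarrow> nat set \<Rightarrow> real" where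
  "expected_error n \<mu> Q \<phi> S =
     (\<integral>D. real (card (sym_diff (\<phi> D) S)) \<partial>data_law n (signal \<mu> S) Q)"

definition adaptive_procedure ::
    "nat \<Rightarrow> real \<Rightarrow> real \<Rightarrow> strategy \<Rightarrow> ((nat \<Rightarrow> obs) \<Rightarrow> nat set) \<Rightarrow> bool" where
  "adaptive_procedure n m \<mu> Q \<phi> \<longleftrightarrow>
     sensing_strategy n Q \<and> within_budget n m \<mu> Q \<and> support_estimator n \<phi>"

definition support_class :: "nat \<Rightarrow> nat \<Rightarrow> nat set set" where
  "support_class n s = {S. S \<subseteq> {1..n} \<and> card S \<in> {s, s + 1, s - 1}}"

end

theory Submission
  imports Defs
begin

text \<open>
  If \<open>S\<close> and \<open>S'\<close> differ only in the coordinate \<open>i\<close>, the chain rule bounds the relative entropy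
  of the data laws under \<open>S\<close> and \<open>S'\<close> by \<open>\<mu>\<^sup>2 / 2\<close> times the expected precision that is spent
  on \<open>i\<close> under \<open>S\<close>. Since the estimator decides correctly about \<open>i\<close> under both supports, this
  entropy must be about \<open>ln (1 / b)\<close>, where \<open>b\<close> is the probability of an error about \<open>i\<close>
  under \<open>S'\<close>. Averaged over the supports of size \<open>s\<close>, the error probability \<open>b\<close> is at most
  about \<open>\<epsilon> / s\<close> when \<open>i\<close> is added to \<open>S\<close>, and \<open>\<epsilon> / (n - s)\<close>, which is no larger, when \<open>i\<close> is
  removed. So each of the \<open>n\<close> coordinates, those in the support included, requires
  \<open>ln (s / \<epsilon>)\<close>, up to a constant, out of a total of \<open>\<mu>\<^sup>2 m / 2\<close>. Using only the \<open>n - s\<close>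
  coordinates outside \<open>S\<close> would lose a term of order \<open>s ln s / n\<close>, which may be unbounded.
\<close>

section \<open>Relative entropy\<close>

text \<open>
  By the variational formula of Donsker and Varadhan this says that the relative entropy of
  \<open>M\<close> with respect to \<open>N\<close> is at most \<open>k\<close>: the test function \<open>ln V\<close> ranges over the bounded
  functions, shifted to be nonnegative. In this form the chain rule for kernels needs neither
  densities nor integrability assumptions.
\<close>

definition entropy_bound :: "'a measure \<Rightarrow> 'a measure \<Rightarrow> ennreal \<Rightarrow> bool" where
  "entropy_bound M N k \<longleftrightarrow>
     (\<forall>V C. V \<in> borel_measurable N \<longrightarrow> (\<forall>x\<in>space N. 1 \<le> V x \<and> V x \<le> C) \<longrightarrow>
        (\<integral>\<^sup>+x. ennreal (ln (V x)) \<partial>M) \<le> ennreal (ln (enn2real (\<integral>\<^sup>+x. ennreal (V x) \<partial>N))) + k)"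

lemma entropy_boundD:
  assumes "entropy_bound M N k" "V \<in> borel_measurable N"
    and "\<And>x. x \<in> space N \<Longrightarrow> 1 \<le> V x" "\<And>x. x \<in> space N \<Longrightarrow> V x \<le> C"
  shows "(\<integral>\<^sup>+x. ennreal (ln (V x)) \<partial>M)
    \<le> ennreal (ln (enn2real (\<integral>\<^sup>+x. ennreal (V x) \<partial>N))) + k"
  using assms unfolding entropy_bound_def by blast

lemma entropy_bound_mono:
  assumes "entropy_bound M N k" "k \<le> l"
  shows "entropy_bound M N l"
  using assms unfolding entropy_bound_def by (meson add_left_mono order_trans)

text \<open>The mean of a function with values in [1, C] stays in [1, C]. Hence
  \<open>enn2real\<close> loses nothing in \<open>entropy_bound\<close>, its logarithm is
  nonnegative, and the mean can itself serve as a value of a test function.\<close>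

lemma (in prob_space) nn_integral_between:
  assumes "V \<in> borel_measurable M"
    and "\<And>x. x \<in> space M \<Longrightarrow> 1 \<le> V x" "\<And>x. x \<in> space M \<Longrightarrow> V x \<le> (C::real)"
  shows "1 \<le> (\<integral>\<^sup>+x. ennreal (V x) \<partial>M)" "(\<integral>\<^sup>+x. ennreal (V x) \<partial>M) \<le> ennreal C"
    "1 \<le> enn2real (\<integral>\<^sup>+x. ennreal (V x) \<partial>M)" "enn2real (\<integral>\<^sup>+x. ennreal (V x) \<partial>M) \<le> C"
    "ennreal (enn2real (\<integral>\<^sup>+x. ennreal (V x) \<partial>M)) = (\<integral>\<^sup>+x. ennreal (V x) \<partial>M)"
proof -
  obtain x0 where "x0 \<in> space M" using not_empty by blast
  then have C: "1 \<le> C" using assms(2,3) by force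
  have "(\<integral>\<^sup>+x. 1 \<partial>M) \<le> (\<integral>\<^sup>+x. ennreal (V x) \<partial>M)"
    by (intro nn_integral_mono) (use assms in simp)
  then show 1: "1 \<le> (\<integral>\<^sup>+x. ennreal (V x) \<partial>M)" by (simp add: emeasure_space_1)
  have "(\<integral>\<^sup>+x. ennreal (V x) \<partial>M) \<le> (\<integral>\<^sup>+x. ennreal C \<partial>M)"
    by (intro nn_integral_mono ennreal_leI) (use assms in simp)
  then show 2: "(\<integral>\<^sup>+x. ennreal (V x) \<partial>M) \<le> ennreal C" by (simp add: emeasure_space_1)
  show 3: "ennreal (enn2real (\<integral>\<^sup>+x. ennreal (V x) \<partial>M)) = (\<integral>\<^sup>+x. ennreal (V x) \<partial>M)"
    using 2 by (metis ennreal_enn2real ennreal_less_top le_less_trans)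
  show "enn2real (\<integral>\<^sup>+x. ennreal (V x) \<partial>M) \<le> C"
    using 2 C by (intro enn2real_leI) auto
  show "1 \<le> enn2real (\<integral>\<^sup>+x. ennreal (V x) \<partial>M)"
    using 1 3 by (metis ennreal_1 ennreal_le_iff enn2real_nonneg)
qed

text \<open>Here \<open>b\<close> may be negative, and then \<open>ennreal b\<close> is 0. This
  spares a proof that the constant in the density bound below is nonnegative.\<close>

lemma ennreal_add_le: "0 \<le> a \<Longrightarrow> ennreal (a + b) \<le> ennreal a + ennreal b"
  by (cases "0 \<le> b") (auto simp: ennreal_plus[symmetric] ennreal_neg simp del: ennreal_plus intro: ennreal_leI)

text \<open>Apply ln y <= y - 1 to y = \<open>\<rho> x * V x / t\<close>, where \<open>t\<close> is
  the mean of \<open>V\<close> under the density, and integrate over \<open>M\<close>. Since y has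
  mean 1, the right side vanishes and only ln t minus the mean of ln \<open>\<rho>\<close> remains.
  The constant is the classical relative entropy.\<close>

lemma entropy_bound_density:
  fixes \<rho> :: "'a \<Rightarrow> real"
  assumes "prob_space M" "prob_space (density M \<rho>)"
    and [measurable]: "\<rho> \<in> borel_measurable M"
    and pos: "\<And>x. 0 < \<rho> x"
    and int: "integrable M (\<lambda>x. ln (\<rho> x))"
  shows "entropy_bound M (density M \<rho>) (ennreal (- (\<integral>x. ln (\<rho> x) \<partial>M)))"
  unfolding entropy_bound_def
proof (intro allI impI)
  interpret M: prob_space M by fact
  interpret N: prob_space "density M \<rho>" by fact
  fix V :: "'a \<Rightarrow> real" and C
  assume "V \<in> borel_measurable (density M \<rho>)" and "\<forall>x\<in>space (density M \<rho>). 1 \<le> V x \<and> V x \<le> C"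
  then have V[measurable]: "V \<in> borel_measurable M"
    and V1: "\<And>x. x \<in> space M \<Longrightarrow> 1 \<le> V x" and VC: "\<And>x. x \<in> space M \<Longrightarrow> V x \<le> C"
    by auto
  define t where "t = enn2real (\<integral>\<^sup>+x. ennreal (V x) \<partial>density M \<rho>)"
  have t1: "1 \<le> t" and t: "ennreal t = (\<integral>\<^sup>+x. ennreal (V x) \<partial>density M \<rho>)"
    using N.nn_integral_between[of V C] V1 VC by (auto simp: t_def)
  have nn: "(\<integral>\<^sup>+x. ennreal (\<rho> x * V x) \<partial>M) = ennreal t"
    unfolding t by (subst nn_integral_density)
      (auto simp: ennreal_mult' pos less_imp_le intro!: nn_integral_cong)
  have nonneg: "0 \<le> \<rho> x * V x" if "x \<in> space M" for x
    using V1[OF that] pos[of x] by simp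
  have intV: "integrable M (\<lambda>x. \<rho> x * V x)"
    by (rule integrableI_nonneg) (use nonneg nn in \<open>auto intro: AE_I2\<close>)
  have eqV: "(\<integral>x. \<rho> x * V x \<partial>M) = t"
    using nn t1 by (subst integral_eq_nn_integral) (auto simp: nonneg)
  have intl: "integrable M (\<lambda>x. ln (V x))"
  proof (rule M.integrable_const_bound)
    show "AE x in M. norm (ln (V x)) \<le> ln C"
      using V1 VC by (intro AE_I2) (fastforce intro: ln_mono)
  qed simp
  have "(\<integral>x. ln (V x) \<partial>M) \<le> (\<integral>x. (ln t - 1) + \<rho> x * V x / t - ln (\<rho> x) \<partial>M)"
  proof (rule integral_mono)
    fix x assume x: "x \<in> space M"
    have p: "0 < \<rho> x" "0 < V x" using pos V1[OF x] by (auto intro: less_le_trans[of 0 1])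
    have "ln (\<rho> x * V x / t) \<le> \<rho> x * V x / t - 1"
      using p t1 by (intro ln_le_minus_one) simp
    then show "ln (V x) \<le> (ln t - 1) + \<rho> x * V x / t - ln (\<rho> x)"
      using p t1 by (simp add: ln_div ln_mult)
  qed (use intl intV int in auto)
  also have "\<dots> = ln t - (\<integral>x. ln (\<rho> x) \<partial>M)"
    using intV int t1 by (simp add: eqV M.prob_space)
  finally have "ennreal (\<integral>x. ln (V x) \<partial>M) \<le> ennreal (ln t + - (\<integral>x. ln (\<rho> x) \<partial>M))"
    by (intro ennreal_leI) simp
  also have "\<dots> \<le> ennreal (ln t) + ennreal (- (\<integral>x. ln (\<rho> x) \<partial>M))"
    by (rule ennreal_add_le) (use t1 in simp)
  also have "ennreal (\<integral>x. ln (V x) \<partial>M) = (\<integral>\<^sup>+x. ennreal (ln (V x)) \<partial>M)"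
    by (rule nn_integral_eq_integral[symmetric]) (use intl V1 in auto)
  finally show "(\<integral>\<^sup>+x. ennreal (ln (V x)) \<partial>M)
      \<le> ennreal (ln (enn2real (\<integral>\<^sup>+x. ennreal (V x) \<partial>density M \<rho>)))
        + ennreal (- (\<integral>x. ln (\<rho> x) \<partial>M))"
    by (simp add: t_def)
qed

lemma entropy_bound_refl: "prob_space M \<Longrightarrow> entropy_bound M M 0"
  using entropy_bound_density[of M "\<lambda>_. 1"] by (simp add: density_1)

text \<open>Data processing: a test function on the image, composed with \<open>f\<close>, is a test
  function on \<open>N\<close> with the same bounds and the same integrals.\<close>

lemma entropy_bound_distr:
  assumes "entropy_bound M N k" and [measurable]: "f \<in> N \<rightarrow>\<^sub>M R" and "sets M = sets N"
  shows "entropy_bound (distr M R f) (distr N R f) k"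
  unfolding entropy_bound_def
proof (intro allI impI)
  fix V :: "'b \<Rightarrow> real" and C
  assume V: "V \<in> borel_measurable (distr N R f)"
    and V1: "\<forall>x\<in>space (distr N R f). 1 \<le> V x \<and> V x \<le> C"
  have [measurable]: "V \<in> borel_measurable R" using V by simp
  have fM[measurable]: "f \<in> M \<rightarrow>\<^sub>M R" using assms by (simp add: measurable_cong_sets[OF assms(3) refl])
  have sp: "f x \<in> space R" if "x \<in> space N" for x
    using measurable_space[OF assms(2) that] .
  show "(\<integral>\<^sup>+x. ennreal (ln (V x)) \<partial>distr M R f)
      \<le> ennreal (ln (enn2real (\<integral>\<^sup>+x. ennreal (V x) \<partial>distr N R f))) + k"
    using entropy_boundD[OF assms(1), of "\<lambda>x. V (f x)" C] V1 sp
    by (simp add: nn_integral_distr)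
qed

text \<open>Chain rule. For fixed \<open>h\<close>, testing \<open>K h\<close> against
  \<open>L h\<close> with \<open>V\<close> leaves \<open>U h\<close>, the mean of \<open>V\<close>
  under \<open>L h\<close>. This \<open>U\<close> again takes values in [1, C], so it is a test
  function for \<open>M\<close> and \<open>N\<close>, and its mean under \<open>N\<close> is that of
  \<open>V\<close> under \<open>N \<bind> L\<close>. The conditional costs are averaged under the
  first law \<open>M\<close>.\<close>

lemma entropy_bound_bind:
  assumes MN: "entropy_bound M N k" and sets_M: "sets M = sets N"
    and "K \<in> N \<rightarrow>\<^sub>M prob_algebra R" "L \<in> N \<rightarrow>\<^sub>M prob_algebra R"
    and KL: "\<And>h. h \<in> space N \<Longrightarrow> entropy_bound (K h) (L h) (c h)"
    and c[measurable]: "c \<in> borel_measurable N"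
  shows "entropy_bound (M \<bind> K) (N \<bind> L) (k + (\<integral>\<^sup>+h. c h \<partial>M))"
proof (cases "space N = {}")
  \<comment> \<open>Over an empty space \<open>bind\<close> collapses to
    \<open>count_space {}\<close>, whose sets need not be those of \<open>R\<close>; the integral on
    the left is then 0.\<close>
  case True
  then have "space M = {}"
    using sets_eq_imp_space_eq[OF sets_M] by simp
  then have "M \<bind> K = count_space {}" by (rule bind_empty)
  then show ?thesis
    by (simp add: entropy_bound_def nn_integral_empty)
next
  case ne: False
  show ?thesis
    unfolding entropy_bound_def
  proof (intro allI impI)
    fix V :: "'b \<Rightarrow> real" and C
    have K[measurable]: "K \<in> M \<rightarrow>\<^sub>M subprob_algebra R" and L[measurable]: "L \<in> N \<rightarrow>\<^sub>M subprob_algebra R"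
      using assms(3,4)[THEN measurable_prob_algebraD] by (simp_all add: measurable_cong_sets[OF sets_M refl])
    have setsL: "sets (L h) = sets R" and prob: "prob_space (L h)"
      if "h \<in> space N" for h
      using measurable_space[OF assms(4) that] by (auto simp: space_prob_algebra)
    have setsNL: "sets (N \<bind> L) = sets R"
      by (rule sets_bind[OF setsL ne])
    assume "V \<in> borel_measurable (N \<bind> L)" and "\<forall>x\<in>space (N \<bind> L). 1 \<le> V x \<and> V x \<le> C"
    then have V[measurable]: "V \<in> borel_measurable R"
      and V1: "\<And>x. x \<in> space R \<Longrightarrow> 1 \<le> V x" and VC: "\<And>x. x \<in> space R \<Longrightarrow> V x \<le> C"
      by (auto simp: sets_eq_imp_space_eq[OF setsNL] measurable_cong_sets[OF setsNL refl])
    define U where "U h = enn2real (\<integral>\<^sup>+x. ennreal (V x) \<partial>L h)" for h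
    have U[measurable]: "U \<in> borel_measurable N"
      unfolding U_def
      by (intro borel_measurable_enn2real measurable_compose[OF L nn_integral_measurable_subprob_algebra])
        measurable
    have VL: "V \<in> borel_measurable (L h)" "space (L h) = space R" if "h \<in> space N" for h
      by (simp_all add: V measurable_cong_sets[OF setsL[OF that] refl] sets_eq_imp_space_eq[OF setsL[OF that]])
    have U1: "1 \<le> U h" "U h \<le> C" "ennreal (U h) = (\<integral>\<^sup>+x. ennreal (V x) \<partial>L h)"
      if "h \<in> space N" for h
      using prob_space.nn_integral_between[OF prob[OF that] VL(1)[OF that], of C] V1 VC VL(2)[OF that]
      by (auto simp: U_def)
    have spM: "space M = space N" using sets_M by (rule sets_eq_imp_space_eq)
    have UM[measurable]: "U \<in> borel_measurable M" and cM[measurable]: "c \<in> borel_measurable M"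
      using U c by (simp_all add: measurable_cong_sets[OF sets_M refl])
    have "(\<integral>\<^sup>+x. ennreal (ln (V x)) \<partial>(M \<bind> K)) = (\<integral>\<^sup>+h. \<integral>\<^sup>+x. ennreal (ln (V x)) \<partial>K h \<partial>M)"
      by (rule nn_integral_bind[OF _ K]) simp
    also have "\<dots> \<le> (\<integral>\<^sup>+h. ennreal (ln (U h)) + c h \<partial>M)"
    proof (rule nn_integral_mono)
      fix h assume "h \<in> space M"
      then have h: "h \<in> space N" using spM by simp
      show "(\<integral>\<^sup>+x. ennreal (ln (V x)) \<partial>K h) \<le> ennreal (ln (U h)) + c h"
        unfolding U_def
        by (rule entropy_boundD[OF KL[OF h], of V C])
          (use V1 VC VL[OF h] in auto)
    qed
    also have "\<dots> = (\<integral>\<^sup>+h. ennreal (ln (U h)) \<partial>M) + (\<integral>\<^sup>+h. c h \<partial>M)"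
      by (rule nn_integral_add) measurable
    also have "(\<integral>\<^sup>+h. ennreal (ln (U h)) \<partial>M)
        \<le> ennreal (ln (enn2real (\<integral>\<^sup>+h. ennreal (U h) \<partial>N))) + k"
      by (rule entropy_boundD[OF MN U]) (use U1 in auto)
    also have "(\<integral>\<^sup>+h. ennreal (U h) \<partial>N) = (\<integral>\<^sup>+x. ennreal (V x) \<partial>(N \<bind> L))"
      by (subst nn_integral_bind[OF _ L]) (use U1 in \<open>auto intro!: nn_integral_cong\<close>)
    finally show "(\<integral>\<^sup>+x. ennreal (ln (V x)) \<partial>(M \<bind> K))
        \<le> ennreal (ln (enn2real (\<integral>\<^sup>+x. ennreal (V x) \<partial>(N \<bind> L)))) + (k + (\<integral>\<^sup>+h. c h \<partial>M))"
      by (simp add: add.assoc add_right_mono)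
  qed
qed

text \<open>The shifted law has density exp(\<open>\<delta> * w - \<delta>\<^sup>2 / 2\<close>) with
  respect to the standard normal law, and since w is centred the logarithm has mean
  \<open>- (\<delta>\<^sup>2 / 2)\<close>.\<close>

lemma entropy_bound_std_normal_shift:
  "entropy_bound std_normal_distribution
     (distr std_normal_distribution borel (\<lambda>w. w + \<delta>)) (ennreal (\<delta>\<^sup>2 / 2))"
proof -
  interpret N: prob_space std_normal_distribution by (rule prob_space_normal_density) simp
  define \<rho> where "\<rho> w = exp (\<delta> * w - \<delta>\<^sup>2 / 2)" for w
  have [measurable]: "\<rho> \<in> borel_measurable borel" unfolding \<rho>_def by measurable
  have d: "distributed std_normal_distribution lborel (\<lambda>w. w) (normal_density 0 1)"
    by (auto simp: distributed_def distr_id2 cong: distr_cong)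
  have "distributed std_normal_distribution lborel (\<lambda>w. \<delta> + 1 * w) (normal_density (\<delta> + 1 * 0) (\<bar>1\<bar> * 1))"
    by (rule N.normal_density_affine[OF d]) auto
  then have "distr std_normal_distribution lborel (\<lambda>w. \<delta> + w) = density lborel (normal_density \<delta> 1)"
    by (simp add: distributed_def)
  moreover have "density std_normal_distribution \<rho> = density lborel (normal_density \<delta> 1)"
  proof -
    have "std_normal_density w * \<rho> w = normal_density \<delta> 1 w" for w
      unfolding normal_density_def \<rho>_def
      by (simp add: exp_add[symmetric]) (simp add: power2_eq_square algebra_simps add_divide_distrib diff_divide_distrib)
    then show ?thesis
      by (subst density_density_eq) (auto simp: ennreal_mult'[symmetric] \<rho>_def normal_density_nonneg)
  qed
  ultimately have eq: "distr std_normal_distribution borel (\<lambda>w. w + \<delta>) = density std_normal_distribution \<rho>"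
    by (simp add: add.commute cong: distr_cong)
  have i: "integrable std_normal_distribution (\<lambda>w. w)" "(\<integral>w. w \<partial>std_normal_distribution) = 0"
    using std_normal_moment_odd[of 0] N.standard_normal_distributed_expectation[OF d]
    by (auto simp: has_bochner_integral_iff integrable_density)
  have ln_\<rho>: "ln (\<rho> w) = \<delta> * w - \<delta>\<^sup>2 / 2" for w by (simp add: \<rho>_def)
  have "entropy_bound std_normal_distribution (density std_normal_distribution \<rho>)
      (ennreal (- (\<integral>w. ln (\<rho> w) \<partial>std_normal_distribution)))"
  proof (rule entropy_bound_density[OF N.prob_space_axioms])
    show "prob_space (density std_normal_distribution \<rho>)"
      unfolding eq[symmetric] by (rule N.prob_space_distr) simp
    show "integrable std_normal_distribution (\<lambda>w. ln (\<rho> w))"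
      unfolding ln_\<rho> by (intro Bochner_Integration.integrable_diff integrable_mult_right i(1)) simp
  qed (simp_all add: \<rho>_def)
  moreover have "(\<integral>w. ln (\<rho> w) \<partial>std_normal_distribution) = - (\<delta>\<^sup>2 / 2)"
    unfolding ln_\<rho> using i N.prob_space by simp
  ultimately show ?thesis by (simp add: eq)
qed

text \<open>Take the test function that is \<open>exp l\<close> on \<open>A\<close> and 1 elsewhere,
  then use ln(1 + y) <= y. The parameter \<open>l\<close> stays free; a large \<open>l\<close> pays
  off when \<open>A\<close> is likely under \<open>M\<close> and rare under
  \<open>N\<close>.\<close>

lemma entropy_bound_event:
  assumes "entropy_bound M N (ennreal k)" "prob_space M" "prob_space N" "sets M = sets N"
    and A: "A \<in> sets N" and "0 \<le> l" "0 \<le> k"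
  shows "l * measure M A \<le> (exp l - 1) * measure N A + k"
proof -
  interpret M: prob_space M by fact
  interpret N: prob_space N by fact
  have AM[measurable]: "A \<in> sets M" and AN[measurable]: "A \<in> sets N" using A assms(4) by simp_all
  define V where "V x = 1 + (exp l - 1) * indicator A x" for x
  have Vm: "V \<in> borel_measurable N" unfolding V_def by measurable
  have e: "0 \<le> exp l - 1" using assms by simp
  have lnV: "ln (V x) = l * indicator A x" for x by (simp add: V_def indicator_def)
  have "(\<integral>\<^sup>+x. ennreal (ln (V x)) \<partial>M) = (\<integral>\<^sup>+x. ennreal l * indicator A x \<partial>M)"
    unfolding lnV by (intro nn_integral_cong) (simp split: split_indicator)
  also have "\<dots> = ennreal (l * measure M A)"
    using assms by (simp add: nn_integral_cmult_indicator M.emeasure_eq_measure ennreal_mult)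
  finally have 1: "(\<integral>\<^sup>+x. ennreal (ln (V x)) \<partial>M) = ennreal (l * measure M A)" .
  have "(\<integral>\<^sup>+x. ennreal (V x) \<partial>N) = (\<integral>\<^sup>+x. 1 + ennreal (exp l - 1) * indicator A x \<partial>N)"
    unfolding V_def using ennreal_plus[of 1 "exp l - 1"] e by (intro nn_integral_cong) (simp split: split_indicator)
  also have "\<dots> = 1 + ennreal ((exp l - 1) * measure N A)"
    using e by (simp add: nn_integral_add nn_integral_cmult_indicator N.emeasure_eq_measure
        ennreal_mult N.prob_space)
  also have "\<dots> = ennreal (1 + (exp l - 1) * measure N A)"
    using e by simp
  finally have 2: "enn2real (\<integral>\<^sup>+x. ennreal (V x) \<partial>N) = 1 + (exp l - 1) * measure N A"
    using e by (simp del: ennreal_plus)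
  have "ennreal (l * measure M A) \<le> ennreal (ln (1 + (exp l - 1) * measure N A)) + ennreal k"
    using entropy_boundD[OF assms(1) Vm, of "exp l"] e
    unfolding 1 2 by (simp add: V_def split: split_indicator)
  also have "\<dots> \<le> ennreal ((exp l - 1) * measure N A) + ennreal k"
    using e by (intro add_right_mono ennreal_leI ln_add_one_self_le_self) simp
  also have "\<dots> = ennreal ((exp l - 1) * measure N A + k)"
    using e \<open>0 \<le> k\<close> by simp
  finally show ?thesis
    using e \<open>0 \<le> k\<close> by (subst (asm) ennreal_le_iff) auto
qed

section \<open>Approximation of events by an algebra\<close>

text \<open>The sets that can be approximated include \<open>G\<close> and are closed under
  complements and countable unions. Both measures are treated at once because a single
  \<open>B\<close> has to serve under two data laws.\<close>

lemma approx_by_algebra: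
  assumes "algebra \<Omega> G" "finite_measure M" "finite_measure N"
    and setsM: "sets M = sigma_sets \<Omega> G" and setsN: "sets N = sigma_sets \<Omega> G"
    and A: "A \<in> sigma_sets \<Omega> G" and "0 < e"
  shows "\<exists>B\<in>G. measure M (sym_diff A B) + measure N (sym_diff A B) < (e::real)"
  using A \<open>0 < e\<close>
proof (induction arbitrary: e)
  interpret G: algebra \<Omega> G by fact
  interpret M: finite_measure M by fact
  interpret N: finite_measure N by fact
  define d where "d A B = measure M (sym_diff A B) + measure N (sym_diff A B)" for A B
  have Gs: "B \<in> sigma_sets \<Omega> G" if "B \<in> G" for B using that by (rule sigma_sets.Basic)
  {
    case (Basic a)
    then show ?case by (intro bexI[of _ a]) auto
  next
    case Empty
    then show ?case by (intro bexI[of _ "{}"]) auto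
  next
    case (Compl a)
    then obtain B where B: "B \<in> G" "measure M (sym_diff a B) + measure N (sym_diff a B) < e" by blast
    have "a \<subseteq> \<Omega>" "B \<subseteq> \<Omega>"
      using sigma_sets_into_sp[OF G.space_closed Compl.hyps] B(1) G.space_closed by auto
    then have "sym_diff (\<Omega> - a) (\<Omega> - B) = sym_diff a B" by blast
    with B show ?case by (intro bexI[of _ "\<Omega> - B"]) auto
  next
    case (Union a)
    have a: "a i \<in> sets M" "a i \<in> sets N" for i using Union.hyps setsM setsN by auto
    let ?U = "\<lambda>n. \<Union>i\<le>n. a i"
    have inc: "incseq ?U" by (intro incseq_SucI UN_mono) auto
    have U: "(\<Union>n. ?U n) = (\<Union>i. a i)" by auto
    have "(\<lambda>n. measure M (?U n)) \<longlonglongrightarrow> measure M (\<Union>i. a i)"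
      "(\<lambda>n. measure N (?U n)) \<longlonglongrightarrow> measure N (\<Union>i. a i)"
      using M.finite_Lim_measure_incseq[OF _ inc] N.finite_Lim_measure_incseq[OF _ inc] a
      unfolding U by auto
    then have "\<forall>\<^sub>F n in sequentially. measure M (\<Union>i. a i) - e/4 < measure M (?U n)"
      "\<forall>\<^sub>F n in sequentially. measure N (\<Union>i. a i) - e/4 < measure N (?U n)"
      using \<open>0 < e\<close> by (auto intro: order_tendstoD)
    then obtain n where n: "measure M (\<Union>i. a i) - e/4 < measure M (?U n)"
      "measure N (\<Union>i. a i) - e/4 < measure N (?U n)"
      using eventually_happens'[OF sequentially_bot eventually_conj] by blast
    \<comment> \<open>Cutting off the union after \<open>n\<close> costs e/4 in each measure; the
      \<open>n + 1\<close> remaining sets share the other e/2.\<close>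
    define \<delta> where "\<delta> = e / (2 * (real n + 1))"
    have \<delta>: "0 < \<delta>" using \<open>0 < e\<close> by (simp add: \<delta>_def)
    have "\<forall>i. \<exists>B\<in>G. d (a i) B < \<delta>"
      using Union.IH[OF \<delta>] by (simp add: d_def)
    then obtain B where B: "\<And>i. B i \<in> G" "\<And>i. d (a i) (B i) < \<delta>" by metis
    have Bs: "B i \<in> sets M" "B i \<in> sets N" for i using Gs B(1) setsM setsN by auto
    let ?B = "\<Union>i\<le>n. B i"
    have sub: "sym_diff (\<Union>i. a i) ?B \<subseteq> ((\<Union>i. a i) - ?U n) \<union> (\<Union>i\<le>n. sym_diff (a i) (B i))"
      by blast
    have est: "measure L (sym_diff (\<Union>i. a i) ?B) \<le> e/4 + (\<Sum>i\<le>n. measure L (sym_diff (a i) (B i)))"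
      if "finite_measure L" and setsL: "sets L = sigma_sets \<Omega> G"
        and nL: "measure L (\<Union>i. a i) - e/4 < measure L (?U n)" for L
    proof -
      interpret L: finite_measure L by fact
      have aL: "a i \<in> sets L" and BL: "B i \<in> sets L" for i
        using a Bs setsM setsL by auto
      have "measure L (sym_diff (\<Union>i. a i) ?B)
          \<le> measure L (((\<Union>i. a i) - ?U n) \<union> (\<Union>i\<le>n. sym_diff (a i) (B i)))"
        by (rule L.finite_measure_mono[OF sub]) (use aL BL in auto)
      also have "\<dots> \<le> measure L ((\<Union>i. a i) - ?U n) + measure L (\<Union>i\<le>n. sym_diff (a i) (B i))"
        by (rule measure_Un_le) (use aL BL in auto)
      also have "measure L (\<Union>i\<le>n. sym_diff (a i) (B i)) \<le> (\<Sum>i\<le>n. measure L (sym_diff (a i) (B i)))"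
        by (rule measure_UNION_le) (use aL BL in auto)
      also have "measure L ((\<Union>i. a i) - ?U n) = measure L (\<Union>i. a i) - measure L (?U n)"
        by (rule L.finite_measure_Diff) (use aL in auto)
      finally show ?thesis using nL by simp
    qed
    note est[OF assms(2) setsM n(1)]
    moreover note est[OF assms(3) setsN n(2)]
    moreover have "(\<Sum>i\<le>n. d (a i) (B i)) < (\<Sum>i\<le>n. \<delta>)"
      by (rule sum_strict_mono) (use B in auto)
    moreover have "(\<Sum>i\<le>n. \<delta>) = e / 2" by (simp add: \<delta>_def field_simps)
    ultimately have "d (\<Union>i. a i) ?B < e"
      unfolding d_def by (simp add: sum.distrib)
    moreover have "?B \<in> G" using B(1) by auto
    ultimately show ?case unfolding d_def by blast
  }
qed

section \<open>One measurement\<close>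

text \<open>The relative entropy of two unit Gaussians whose means differ by \<open>\<delta>\<close> is \<open>\<delta>\<^sup>2 / 2\<close>.\<close>

definition sensing_cost :: "(nat \<Rightarrow> real) \<Rightarrow> (nat \<Rightarrow> real) \<Rightarrow> action \<Rightarrow> ennreal" where
  "sensing_cost x x' b = ennreal ((snd b * (x' (fst b) - x (fst b)))\<^sup>2 / 2)"

lemma measurable_observe:
  "(\<lambda>(b, w). observe x b w) \<in> action_space n \<Otimes>\<^sub>M borel \<rightarrow>\<^sub>M obs_space n"
proof -
  have "x \<in> count_space {1..n} \<rightarrow>\<^sub>M borel" by simp
  then show ?thesis
    unfolding observe_def obs_space_def action_space_def split_beta by measurable
qed

lemma measurable_sensing_cost[measurable]:
  "sensing_cost x x' \<in> borel_measurable (action_space n)"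
proof -
  have [measurable]: "x \<in> count_space {1..n} \<rightarrow>\<^sub>M borel" "x' \<in> count_space {1..n} \<rightarrow>\<^sub>M borel" by simp_all
  show ?thesis unfolding sensing_cost_def action_space_def by measurable
qed

lemma observe_kernel:
  "(\<lambda>b. distr std_normal_distribution (obs_space n) (observe x b))
    \<in> action_space n \<rightarrow>\<^sub>M prob_algebra (obs_space n)"
proof (rule measurable_distr_prob_space2[OF measurable_const])
  show "std_normal_distribution \<in> space (prob_algebra borel)"
    by (simp add: space_prob_algebra prob_space_normal_density)
qed (rule measurable_observe)

text \<open>The noise is independent of the action, so by Fubini the kernel is a mixture over
  actions. In this form the chain rule applies, with the choice of the action as its first
  stage.\<close>

lemma obs_kernel_eq_bind:
  assumes "prob_space (Q k h)" and sets_Q: "sets (Q k h) = sets (action_space n)"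
  shows "obs_kernel n x Q k h
    = Q k h \<bind> (\<lambda>b. distr std_normal_distribution (obs_space n) (observe x b))"
proof -
  let ?K = "\<lambda>b. distr std_normal_distribution (obs_space n) (observe x b)"
  interpret q: prob_space "Q k h" by fact
  interpret N: prob_space std_normal_distribution by (rule prob_space_normal_density) simp
  have obs: "(\<lambda>(b, w). observe x b w) \<in> Q k h \<Otimes>\<^sub>M std_normal_distribution \<rightarrow>\<^sub>M obs_space n"
    using measurable_observe[of x n]
    by (subst measurable_cong_sets[OF sets_pair_measure_cong[OF sets_Q] refl]) auto
  have obs_b: "observe x b \<in> std_normal_distribution \<rightarrow>\<^sub>M obs_space n" if "b \<in> space (Q k h)" for b
    using measurable_Pair2[OF obs, of b] that by simp
  have K: "?K \<in> Q k h \<rightarrow>\<^sub>M subprob_algebra (obs_space n)"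
    using measurable_prob_algebraD[OF observe_kernel[of n x]]
    by (simp add: measurable_cong_sets[OF sets_Q refl])
  show ?thesis
  proof (rule measure_eqI)
    show "sets (obs_kernel n x Q k h) = sets (Q k h \<bind> ?K)"
      by (subst sets_bind) (auto simp: obs_kernel_def q.not_empty)
    fix A assume "A \<in> sets (obs_kernel n x Q k h)"
    then have A: "A \<in> sets (obs_space n)" by (simp add: obs_kernel_def)
    let ?A = "(\<lambda>(b, w). observe x b w) -` A \<inter> space (Q k h \<Otimes>\<^sub>M std_normal_distribution)"
    have "emeasure (obs_kernel n x Q k h) A = emeasure (Q k h \<Otimes>\<^sub>M std_normal_distribution) ?A"
      by (simp add: obs_kernel_def emeasure_distr[OF obs A])
    also have "\<dots> = (\<integral>\<^sup>+b. emeasure std_normal_distribution (Pair b -` ?A) \<partial>Q k h)"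
      by (rule N.emeasure_pair_measure_alt[OF measurable_sets[OF obs A]])
    also have "\<dots> = (\<integral>\<^sup>+b. emeasure (?K b) A \<partial>Q k h)"
      by (auto intro!: nn_integral_cong arg_cong2[where f=emeasure]
          simp: emeasure_distr[OF obs_b A] space_pair_measure)
    also have "\<dots> = emeasure (Q k h \<bind> ?K) A"
      by (rule emeasure_bind[OF q.not_empty K A, symmetric])
    finally show "emeasure (obs_kernel n x Q k h) A = emeasure (Q k h \<bind> ?K) A" .
  qed
qed

text \<open>This also holds for \<open>\<Gamma> = 0\<close>, when both sides record \<open>0\<close>.\<close>

lemma observe_shift: "observe x' b w = observe x b (w + snd b * (x' (fst b) - x (fst b)))"
  by (auto simp: observe_def split_beta field_simps)

lemma sensing_strategyD:
  assumes "sensing_strategy n Q"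
  shows "Q k \<in> history_space n k \<rightarrow>\<^sub>M prob_algebra (action_space n)"
    and "h \<in> space (history_space n k) \<Longrightarrow> prob_space (Q k h)"
    and "h \<in> space (history_space n k) \<Longrightarrow> sets (Q k h) = sets (action_space n)"
proof -
  show 1: "Q k \<in> history_space n k \<rightarrow>\<^sub>M prob_algebra (action_space n)"
    using assms by (simp add: sensing_strategy_def)
  show "h \<in> space (history_space n k) \<Longrightarrow> prob_space (Q k h)"
    "h \<in> space (history_space n k) \<Longrightarrow> sets (Q k h) = sets (action_space n)"
    using measurable_space[OF 1] by (auto simp: space_prob_algebra)
qed

text \<open>The action is drawn from \<open>Q k h\<close> under both signals and contributes no
  entropy. Given the action, \<open>observe_shift\<close> turns the change of signal into a shift of
  the noise, and data processing transfers the Gaussian bound.\<close>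

lemma entropy_bound_obs_kernel:
  assumes Q: "sensing_strategy n Q" and h: "h \<in> space (history_space n k)"
  shows "entropy_bound (obs_kernel n x Q k h) (obs_kernel n x' Q k h)
    (\<integral>\<^sup>+b. sensing_cost x x' b \<partial>Q k h)"
proof -
  note q = sensing_strategyD(2,3)[OF Q h]
  have K: "(\<lambda>b. distr std_normal_distribution (obs_space n) (observe x b))
      \<in> Q k h \<rightarrow>\<^sub>M prob_algebra (obs_space n)" for x
    using observe_kernel[of n x] by (simp add: measurable_cong_sets[OF q(2) refl])
  have "entropy_bound (obs_kernel n x Q k h) (obs_kernel n x' Q k h)
      (0 + (\<integral>\<^sup>+b. sensing_cost x x' b \<partial>Q k h))"
    unfolding obs_kernel_eq_bind[where Q=Q, OF q]
  proof (rule entropy_bound_bind[OF entropy_bound_refl[OF q(1)] refl K K])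
    show "sensing_cost x x' \<in> borel_measurable (Q k h)"
      using measurable_sensing_cost by (simp add: measurable_cong_sets[OF q(2) refl])
    fix b assume "b \<in> space (Q k h)"
    then have b: "b \<in> space (action_space n)" by (simp add: sets_eq_imp_space_eq[OF q(2)])
    have obs: "observe x b \<in> borel \<rightarrow>\<^sub>M obs_space n"
      using measurable_Pair2[OF measurable_observe b] by simp
    let ?\<delta> = "snd b * (x' (fst b) - x (fst b))"
    have "distr std_normal_distribution (obs_space n) (observe x' b)
        = distr (distr std_normal_distribution borel (\<lambda>w. w + ?\<delta>)) (obs_space n) (observe x b)"
      by (subst distr_distr) (auto simp: obs comp_def observe_shift[of x' b _ x] intro!: distr_cong)
    moreover have "entropy_bound (distr std_normal_distribution (obs_space n) (observe x b))
        (distr (distr std_normal_distribution borel (\<lambda>w. w + ?\<delta>)) (obs_space n) (observe x b))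
        (ennreal (?\<delta>\<^sup>2 / 2))"
      by (rule entropy_bound_distr[OF entropy_bound_std_normal_shift]) (use obs in auto)
    ultimately show "entropy_bound (distr std_normal_distribution (obs_space n) (observe x b))
        (distr std_normal_distribution (obs_space n) (observe x' b)) (sensing_cost x x' b)"
      by (simp add: sensing_cost_def)
  qed
  then show ?thesis by simp
qed

text \<open>\<open>observe\<close> records the action unchanged, so the noise integrates
  out.\<close>

lemma nn_integral_obs_kernel_action:
  assumes Q: "sensing_strategy n Q" and h: "h \<in> space (history_space n k)"
    and f[measurable]: "f \<in> borel_measurable (action_space n)"
  shows "(\<integral>\<^sup>+y. f (snd y) \<partial>obs_kernel n x Q k h) = (\<integral>\<^sup>+b. f b \<partial>Q k h)"
proof -
  note q = sensing_strategyD(2,3)[OF Q h]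
  have K: "(\<lambda>b. distr std_normal_distribution (obs_space n) (observe x b))
      \<in> Q k h \<rightarrow>\<^sub>M prob_algebra (obs_space n)" for x
    using observe_kernel[of n x] by (simp add: measurable_cong_sets[OF q(2) refl])
  interpret N: prob_space std_normal_distribution by (rule prob_space_normal_density) simp
  have [measurable]: "(\<lambda>y. f (snd y)) \<in> borel_measurable (obs_space n)"
    unfolding obs_space_def by measurable
  have "(\<integral>\<^sup>+y. f (snd y) \<partial>obs_kernel n x Q k h)
      = (\<integral>\<^sup>+b. \<integral>\<^sup>+y. f (snd y) \<partial>distr std_normal_distribution (obs_space n) (observe x b) \<partial>Q k h)"
    unfolding obs_kernel_eq_bind[where Q=Q, OF q]
    by (rule nn_integral_bind[OF _ measurable_prob_algebraD[OF K]]) simp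
  also have "\<dots> = (\<integral>\<^sup>+b. f b \<partial>Q k h)"
  proof (rule nn_integral_cong)
    fix b assume "b \<in> space (Q k h)"
    then have b: "b \<in> space (action_space n)" by (simp add: sets_eq_imp_space_eq[OF q(2)])
    have obs: "observe x b \<in> borel \<rightarrow>\<^sub>M obs_space n"
      using measurable_Pair2[OF measurable_observe b] by simp
    have "snd (observe x b w) = b" for w by (simp add: observe_def split_beta)
    then show "(\<integral>\<^sup>+y. f (snd y) \<partial>distr std_normal_distribution (obs_space n) (observe x b)) = f b"
      using obs N.emeasure_space_1 by (simp add: nn_integral_distr)
  qed
  finally show ?thesis .
qed

section \<open>The law of the data\<close>

definition history_law :: "nat \<Rightarrow> (nat \<Rightarrow> real) \<Rightarrow> strategy \<Rightarrow> nat \<Rightarrow> (nat \<Rightarrow> obs) measure" where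
  "history_law n x Q k = distr (data_law n x Q) (history_space n k) (\<lambda>D. restrict D {0..<k})"

lemma sets_history_law[simp]: "sets (history_law n x Q k) = sets (history_space n k)"
  by (simp add: history_law_def)

lemma space_history_law[simp]: "space (history_law n x Q k) = space (history_space n k)"
  by (simp add: history_law_def)

definition history_kernel :: "nat \<Rightarrow> (nat \<Rightarrow> real) \<Rightarrow> strategy \<Rightarrow> nat \<Rightarrow> (nat \<Rightarrow> obs) \<Rightarrow> (nat \<Rightarrow> obs) measure"
  where "history_kernel n x Q k h = distr (obs_kernel n x Q k h) (history_space n (Suc k)) (fun_upd h k)"

text \<open>Identifies the marginals of the Ionescu-Tulcea limit with compositions of one-step
  kernels, which makes induction on the number of measurements possible.\<close>

lemma history_law_rec:
  assumes Q: "sensing_strategy n Q"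
  shows "history_law n x Q 0 = return (history_space n 0) (\<lambda>_. undefined)"
    and "history_law n x Q (Suc k) = history_law n x Q k \<bind> history_kernel n x Q k"
    and "history_kernel n x Q k \<in> history_space n k \<rightarrow>\<^sub>M prob_algebra (history_space n (Suc k))"
proof -
  interpret Ionescu_Tulcea "obs_kernel n x Q" "\<lambda>_. obs_space n"
    by (rule Ionescu_Tulcea_obs_kernel[OF Q])
  have C: "history_law n x Q k = C 0 k (\<lambda>_. undefined)" for k
  proof -
    \<comment> \<open>\<open>CI\<close> runs the kernels up to the least bound of its index set and
      then projects; for \<open>{0..<k}\<close> this bound is \<open>k\<close> itself, so nothing is
      projected away.\<close>
    have "up_to {0..<k} = k"
      using up_to_iff_Ico[of "{0..<k}" k] up_to[of "{0..<k}"]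
      by (intro antisym) (auto simp: subset_eq not_less[symmetric])
    then show ?thesis
      using distr_C[of k k "\<lambda>_. undefined" 0]
      by (simp add: history_law_def distr_data_law[OF Q] CI_def)
  qed
  have eP: "eP k = history_kernel n x Q k" for k
    by (simp add: fun_eq_iff eP_def history_kernel_def history_space_def)
  show "history_law n x Q 0 = return (history_space n 0) (\<lambda>_. undefined)"
    by (simp add: C history_space_def)
  show "history_law n x Q (Suc k) = history_law n x Q k \<bind> history_kernel n x Q k"
    by (simp add: C eP)
  show "history_kernel n x Q k \<in> history_space n k \<rightarrow>\<^sub>M prob_algebra (history_space n (Suc k))"
    using measurable_eP[of k] prob_space_eP[of _ k] unfolding eP history_space_def
    by (rule measurable_prob_algebraI[rotated])
qed

lemma measurable_fun_upd_history:
  assumes "h \<in> space (history_space n k)"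
  shows "fun_upd h k \<in> obs_space n \<rightarrow>\<^sub>M history_space n (Suc k)"
  unfolding history_space_def
  by (rule measurable_fun_upd[where J="{0..<k}"]) (use assms in \<open>auto simp: history_space_def\<close>)

lemma entropy_bound_history_kernel:
  assumes Q: "sensing_strategy n Q" and h: "h \<in> space (history_space n k)"
  shows "entropy_bound (history_kernel n x Q k h) (history_kernel n x' Q k h)
    (\<integral>\<^sup>+b. sensing_cost x x' b \<partial>Q k h)"
  unfolding history_kernel_def
  by (rule entropy_bound_distr[OF entropy_bound_obs_kernel[OF Q h]])
    (use measurable_fun_upd_history[OF h] in \<open>simp_all add: obs_kernel_def cong: measurable_cong_sets\<close>)

lemma measurable_restrict_data:
  "sensing_strategy n Q \<Longrightarrow> (\<lambda>D. restrict D {0..<k}) \<in> data_law n x Q \<rightarrow>\<^sub>M history_space n k"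
  unfolding measurable_cong_sets[OF sets_data_law refl] data_space_def history_space_def
  by (rule measurable_restrict_subset) simp

lemma measurable_data_action:
  assumes "sensing_strategy n Q" and f: "f \<in> borel_measurable (action_space n)"
  shows "(\<lambda>D. f (snd (D j))) \<in> borel_measurable (data_law n x Q)"
  unfolding measurable_cong_sets[OF sets_data_law[OF assms(1)] refl] data_space_def
proof (rule measurable_compose[OF measurable_component_singleton])
  show "(\<lambda>y. f (snd y)) \<in> borel_measurable (obs_space n)"
    unfolding obs_space_def using f by measurable
qed simp

text \<open>The chain rule produces costs averaged over histories. Rewritten as expectations over
  the complete data, they can be summed over time and compared with the budget.\<close>

lemma nn_integral_data_action:
  assumes Q: "sensing_strategy n Q" and f[measurable]: "f \<in> borel_measurable (action_space n)"
  shows "(\<integral>\<^sup>+D. f (snd (D k)) \<partial>data_law n x Q) = (\<integral>\<^sup>+h. \<integral>\<^sup>+b. f b \<partial>Q k h \<partial>history_law n x Q k)"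
proof -
  have fs[measurable]: "(\<lambda>y. f (snd y)) \<in> borel_measurable (obs_space n)"
    unfolding obs_space_def by measurable
  have fk: "(\<lambda>h. f (snd (h k))) \<in> borel_measurable (history_space n (Suc k))"
    unfolding history_space_def
  proof (rule measurable_compose[OF measurable_component_singleton])
    show "(\<lambda>y. f (snd y)) \<in> borel_measurable (obs_space n)" by (rule fs)
  qed simp
  have "(\<integral>\<^sup>+D. f (snd (D k)) \<partial>data_law n x Q) = (\<integral>\<^sup>+h. f (snd (h k)) \<partial>history_law n x Q (Suc k))"
    unfolding history_law_def by (subst nn_integral_distr[OF measurable_restrict_data[OF Q]]) (use fk in auto)
  also have "\<dots> = (\<integral>\<^sup>+h. \<integral>\<^sup>+h'. f (snd (h' k)) \<partial>history_kernel n x Q k h \<partial>history_law n x Q k)"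
    unfolding history_law_rec(2)[OF Q]
    by (rule nn_integral_bind[OF fk])
      (use measurable_prob_algebraD[OF history_law_rec(3)[OF Q]] in \<open>simp cong: measurable_cong_sets\<close>)
  also have "\<dots> = (\<integral>\<^sup>+h. \<integral>\<^sup>+b. f b \<partial>Q k h \<partial>history_law n x Q k)"
  proof (rule nn_integral_cong)
    fix h assume "h \<in> space (history_law n x Q k)"
    then have h: "h \<in> space (history_space n k)" by simp
    have "(\<integral>\<^sup>+h'. f (snd (h' k)) \<partial>history_kernel n x Q k h) = (\<integral>\<^sup>+y. f (snd y) \<partial>obs_kernel n x Q k h)"
      unfolding history_kernel_def
      by (subst nn_integral_distr)
        (use measurable_fun_upd_history[OF h] fk in \<open>simp_all add: obs_kernel_def cong: measurable_cong_sets\<close>)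
    also have "\<dots> = (\<integral>\<^sup>+b. f b \<partial>Q k h)"
      by (rule nn_integral_obs_kernel_action[OF Q h f])
    finally show "(\<integral>\<^sup>+h'. f (snd (h' k)) \<partial>history_kernel n x Q k h) = (\<integral>\<^sup>+b. f b \<partial>Q k h)" .
  qed
  finally show ?thesis .
qed

lemma prob_space_history_law: "sensing_strategy n Q \<Longrightarrow> prob_space (history_law n x Q k)"
  unfolding history_law_def
  by (rule prob_space.prob_space_distr[OF prob_space_data_law measurable_restrict_data])

text \<open>By the chain rule each measurement adds the expected cost of its action. All these
  expectations are under \<open>x\<close>, so only the precision spent under the first signal
  matters.\<close>

lemma entropy_bound_history_law:
  assumes Q: "sensing_strategy n Q"
  shows "entropy_bound (history_law n x Q k) (history_law n x' Q k)
    (\<integral>\<^sup>+D. (\<Sum>j<k. sensing_cost x x' (snd (D j))) \<partial>data_law n x Q)"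
proof (induction k)
  case 0
  show ?case
    using entropy_bound_refl[OF prob_space_history_law[OF Q, of x 0]]
    by (simp add: history_law_rec(1)[OF Q])
next
  case (Suc k)
  have c: "(\<lambda>h. \<integral>\<^sup>+b. sensing_cost x x' b \<partial>Q k h) \<in> borel_measurable (history_space n k)"
    by (rule measurable_compose[OF measurable_prob_algebraD[OF sensing_strategyD(1)[OF Q]]
          nn_integral_measurable_subprob_algebra[OF measurable_sensing_cost]])
  have "entropy_bound (history_law n x Q (Suc k)) (history_law n x' Q (Suc k))
      ((\<integral>\<^sup>+D. (\<Sum>j<k. sensing_cost x x' (snd (D j))) \<partial>data_law n x Q)
        + (\<integral>\<^sup>+h. \<integral>\<^sup>+b. sensing_cost x x' b \<partial>Q k h \<partial>history_law n x Q k))"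
    unfolding history_law_rec(2)[OF Q]
    by (rule entropy_bound_bind[OF Suc])
      (use history_law_rec(3)[OF Q] entropy_bound_history_kernel[OF Q] c
        in \<open>simp_all cong: measurable_cong_sets\<close>)
  also have "(\<integral>\<^sup>+h. \<integral>\<^sup>+b. sensing_cost x x' b \<partial>Q k h \<partial>history_law n x Q k)
      = (\<integral>\<^sup>+D. sensing_cost x x' (snd (D k)) \<partial>data_law n x Q)"
    by (rule nn_integral_data_action[OF Q measurable_sensing_cost, symmetric])
  finally show ?case
    using measurable_data_action[OF Q measurable_sensing_cost]
    by (simp add: nn_integral_add add.commute)
qed

section \<open>From finite histories to the complete data\<close>

text \<open>The entropy bound concerns finite histories, but an estimator sees all observations. An
  event about finitely many observations that is close to \<open>A\<close> under both laws bridges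
  the gap.\<close>

lemma data_law_event_bound:
  assumes Q: "sensing_strategy n Q" and A: "A \<in> sets (data_space n)"
    and cost: "(\<integral>\<^sup>+D. (\<Sum>j. sensing_cost x x' (snd (D j))) \<partial>data_law n x Q) \<le> ennreal \<kappa>"
    and "0 \<le> l" "0 \<le> \<kappa>"
  shows "l * measure (data_law n x Q) A \<le> (exp l - 1) * measure (data_law n x' Q) A + \<kappa>"
proof (rule field_le_epsilon)
  fix e :: real assume "0 < e"
  let ?P = "data_law n x Q" and ?P' = "data_law n x' Q"
  interpret P: prob_space ?P by (rule prob_space_data_law[OF Q])
  interpret P': prob_space ?P' by (rule prob_space_data_law[OF Q])
  interpret Ionescu_Tulcea "obs_kernel n x Q" "\<lambda>_. obs_space n"
    by (rule Ionescu_Tulcea_obs_kernel[OF Q])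
  have gen: "sets (data_space n) = sigma_sets (space (PiM UNIV (\<lambda>_. obs_space n))) PF.generator"
    by (simp add: data_space_def PF.sets_PiM_generator)
  \<comment> \<open>Passing from \<open>A\<close> to \<open>B\<close> loses at most
    \<open>l * \<delta>\<close> under the first law and \<open>(exp l - 1) * \<delta>\<close> under
    the second, together less than \<open>e\<close>.\<close>
  define \<delta> where "\<delta> = e / (exp l + l)"
  have \<delta>: "0 < \<delta>" using \<open>0 < e\<close> \<open>0 \<le> l\<close> by (simp add: \<delta>_def add_pos_nonneg)
  obtain B where "B \<in> PF.generator" and B: "measure ?P (sym_diff A B) + measure ?P' (sym_diff A B) < \<delta>"
    using approx_by_algebra[OF PF.algebra_generator P.finite_measure_axioms P'.finite_measure_axioms
        sets_data_law[OF Q, unfolded gen] sets_data_law[OF Q, unfolded gen] A[unfolded gen] \<delta>]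
    by blast
  then obtain J X where J: "finite J" and X: "X \<in> sets (PiM J (\<lambda>_. obs_space n))"
    and B_eq: "B = prod_emb UNIV (\<lambda>_. obs_space n) J X"
    by (auto elim: PF.generator.cases)
  obtain k where k: "J \<subseteq> {0..<k}" using J by (meson up_to)
  \<comment> \<open>The same cylinder, read as an event about histories of length
    \<open>k\<close>.\<close>
  define B' where "B' = prod_emb {0..<k} (\<lambda>_. obs_space n) J X"
  have B': "B' \<in> sets (history_space n k)"
    unfolding B'_def history_space_def by (rule measurable_prod_emb[OF k X])
  have B'_eq: "(\<lambda>D. restrict D {0..<k}) -` B' \<inter> space (data_law n y Q) = B" for y
    using k sets_eq_imp_space_eq[OF sets_data_law[OF Q, of y]]
    by (auto simp: B_eq B'_def prod_emb_def data_space_def space_PiM PiE_iff Int_absorb1 Int_absorb2)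
  have meas: "measure (history_law n y Q k) B' = measure (data_law n y Q) B" for y
    unfolding history_law_def
    by (subst measure_distr[OF measurable_restrict_data[OF Q] B']) (simp add: B'_eq)
  \<comment> \<open>The total cost dominates that of the first \<open>k\<close> steps, so the
    constant does not depend on \<open>k\<close>, which varies with \<open>e\<close>.\<close>
  have "entropy_bound (history_law n x Q k) (history_law n x' Q k) (ennreal \<kappa>)"
  proof (rule entropy_bound_mono[OF entropy_bound_history_law[OF Q]])
    have "(\<integral>\<^sup>+D. (\<Sum>j<k. sensing_cost x x' (snd (D j))) \<partial>?P)
        \<le> (\<integral>\<^sup>+D. (\<Sum>j. sensing_cost x x' (snd (D j))) \<partial>?P)"
      by (intro nn_integral_mono sum_le_suminf) auto
    with cost show "(\<integral>\<^sup>+D. (\<Sum>j<k. sensing_cost x x' (snd (D j))) \<partial>?P) \<le> ennreal \<kappa>" by simp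
  qed
  from entropy_bound_event[OF this prob_space_history_law[OF Q] prob_space_history_law[OF Q] _ _ \<open>0 \<le> l\<close> \<open>0 \<le> \<kappa>\<close>, of B']
  have main: "l * measure ?P B \<le> (exp l - 1) * measure ?P' B + \<kappa>"
    using B' by (simp add: meas)
  have As: "A \<in> sets (data_law n y Q)" for y using A by (simp add: sets_data_law[OF Q])
  have Bs: "B \<in> sets (data_law n y Q)" for y
    unfolding B'_eq[of y, symmetric] by (rule measurable_sets[OF measurable_restrict_data[OF Q] B'])
  have "measure ?P A \<le> measure ?P (B \<union> sym_diff A B)"
    by (rule P.finite_measure_mono) (use As Bs in auto)
  also have "\<dots> \<le> measure ?P B + measure ?P (sym_diff A B)"
    by (rule measure_Un_le) (use As Bs in auto)
  finally have PA: "measure ?P A \<le> measure ?P B + \<delta>"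
    using B measure_nonneg[of ?P' "sym_diff A B"] by linarith
  have "measure ?P' B \<le> measure ?P' (A \<union> sym_diff A B)"
    by (rule P'.finite_measure_mono) (use As Bs in auto)
  also have "\<dots> \<le> measure ?P' A + measure ?P' (sym_diff A B)"
    by (rule measure_Un_le) (use As Bs in auto)
  finally have PB: "measure ?P' B \<le> measure ?P' A + \<delta>"
    using B measure_nonneg[of ?P "sym_diff A B"] by linarith
  have "l * measure ?P A \<le> l * (measure ?P B + \<delta>)"
    using PA \<open>0 \<le> l\<close> by (rule mult_left_mono)
  also have "\<dots> \<le> (exp l - 1) * measure ?P' B + \<kappa> + l * \<delta>"
    using main by (simp add: algebra_simps)
  also have "(exp l - 1) * measure ?P' B \<le> (exp l - 1) * (measure ?P' A + \<delta>)"
    using PB \<open>0 \<le> l\<close> by (intro mult_left_mono) auto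
  also have "(exp l - 1) * (measure ?P' A + \<delta>) + \<kappa> + l * \<delta>
      = (exp l - 1) * measure ?P' A + \<kappa> + (exp l + l) * \<delta> - \<delta>"
    by (simp add: algebra_simps)
  also have "(exp l + l) * \<delta> = e"
    using \<open>0 \<le> l\<close> unfolding \<delta>_def by (simp add: add_pos_nonneg less_imp_neq[symmetric])
  finally show "l * measure ?P A \<le> (exp l - 1) * measure ?P' A + \<kappa> + e"
    using \<delta> by simp
qed

section \<open>Errors coordinate by coordinate\<close>

definition coordinate_error ::
    "nat \<Rightarrow> real \<Rightarrow> strategy \<Rightarrow> ((nat \<Rightarrow> obs) \<Rightarrow> nat set) \<Rightarrow> nat set \<Rightarrow> nat \<Rightarrow> real" where
  "coordinate_error n \<mu> Q \<phi> S i =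
     measure (data_law n (signal \<mu> S) Q) {D \<in> space (data_space n). (i \<in> \<phi> D) \<noteq> (i \<in> S)}"

lemma sets_estimator_event:
  assumes "support_estimator n \<phi>"
  shows "{D \<in> space (data_space n). i \<in> \<phi> D} \<in> sets (data_space n)"
proof -
  have "{D \<in> space (data_space n). i \<in> \<phi> D} = \<phi> -` {T. T \<subseteq> {1..n} \<and> i \<in> T} \<inter> space (data_space n)"
    using measurable_space[OF assms[unfolded support_estimator_def]] by auto
  also have "\<dots> \<in> sets (data_space n)"
    by (rule measurable_sets[OF assms[unfolded support_estimator_def]]) auto
  finally show ?thesis .
qed

lemma sets_coordinate_event:
  assumes "support_estimator n \<phi>"
  shows "{D \<in> space (data_space n). (i \<in> \<phi> D) = b} \<in> sets (data_space n)"
proof (cases b)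
  case False
  have "{D \<in> space (data_space n). (i \<in> \<phi> D) = b}
      = space (data_space n) - {D \<in> space (data_space n). i \<in> \<phi> D}"
    using False by auto
  then show ?thesis using sets_estimator_event[OF assms] by auto
qed (use sets_estimator_event[OF assms] in simp)

text \<open>The distance counts the wrongly decided coordinates, so linearity turns the risk into a
  sum of error probabilities.\<close>

lemma expected_error_eq_sum:
  assumes Q: "sensing_strategy n Q" and \<phi>: "support_estimator n \<phi>" and S: "S \<subseteq> {1..n}"
  shows "expected_error n \<mu> Q \<phi> S = (\<Sum>i\<in>{1..n}. coordinate_error n \<mu> Q \<phi> S i)"
proof -
  let ?P = "data_law n (signal \<mu> S) Q"
  let ?E = "\<lambda>i. {D \<in> space (data_space n). (i \<in> \<phi> D) \<noteq> (i \<in> S)}"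
  interpret P: prob_space ?P by (rule prob_space_data_law[OF Q])
  have E: "?E i \<in> sets ?P" for i
    using sets_coordinate_event[OF \<phi>, of i "i \<notin> S"] by (simp add: sets_data_law[OF Q])
  have sp: "space ?P = space (data_space n)"
    by (rule sets_eq_imp_space_eq[OF sets_data_law[OF Q]])
  have "expected_error n \<mu> Q \<phi> S = (\<integral>D. (\<Sum>i\<in>{1..n}. indicator (?E i) D) \<partial>?P)"
    unfolding expected_error_def
  proof (rule Bochner_Integration.integral_cong[OF refl])
    fix D assume "D \<in> space ?P"
    then have D: "D \<in> space (data_space n)" by (simp add: sp)
    have "\<phi> D \<subseteq> {1..n}"
      using measurable_space[OF \<phi>[unfolded support_estimator_def] D] by simp
    then have "sym_diff (\<phi> D) S = {i \<in> {1..n}. (i \<in> \<phi> D) \<noteq> (i \<in> S)}" using S by auto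
    then have "real (card (sym_diff (\<phi> D) S)) = (\<Sum>i | i \<in> {1..n} \<and> (i \<in> \<phi> D) \<noteq> (i \<in> S). 1)"
      by simp
    also have "\<dots> = (\<Sum>i\<in>{1..n}. indicator (?E i) D)"
      unfolding sum.inter_filter[OF finite_atLeastAtMost]
      by (rule sum.cong) (use D in \<open>auto split: split_indicator\<close>)
    finally show "real (card (sym_diff (\<phi> D) S)) = (\<Sum>i\<in>{1..n}. indicator (?E i) D)" .
  qed
  also have "\<dots> = (\<Sum>i\<in>{1..n}. measure ?P (?E i))"
  proof (subst Bochner_Integration.integral_sum)
    show "integrable ?P (indicator (?E i) :: _ \<Rightarrow> real)" for i
      by (rule integrable_real_indicator[OF E]) (simp add: P.emeasure_eq_measure)
    show "(\<Sum>i\<in>{1..n}. \<integral>D. indicator (?E i) D \<partial>?P) = (\<Sum>i\<in>{1..n}. measure ?P (?E i))"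
      by (intro sum.cong refl) (auto simp: sp intro!: arg_cong[where f="measure ?P"])
  qed
  finally show ?thesis by (simp add: coordinate_error_def)
qed

text \<open>Flipping \<open>i\<close> changes an observation only if \<open>i\<close> is the
  measured entry, so at most the term \<open>i = fst b\<close> survives. It is absent when
  \<open>fst b\<close> lies outside \<open>{1..n}\<close>.\<close>

lemma sum_sensing_cost_le:
  "(\<Sum>i\<in>{1..n}. sensing_cost (signal \<mu> S) (signal \<mu> (sym_diff S {i})) b)
    \<le> ennreal (\<mu>\<^sup>2 / 2) * ennreal ((snd b)\<^sup>2)"
proof -
  have "sensing_cost (signal \<mu> S) (signal \<mu> (sym_diff S {i})) b
      = (if i = fst b then ennreal (\<mu>\<^sup>2 / 2) * ennreal ((snd b)\<^sup>2) else 0)" for i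
    by (auto simp: sensing_cost_def signal_def ennreal_mult[symmetric] power_mult_distrib mult.commute)
  then show ?thesis by simp
qed

text \<open>Each measurement is charged to a single coordinate, so all \<open>n\<close> flips
  together share one budget under the law for \<open>S\<close>.\<close>

lemma sum_sensing_cost_budget:
  assumes Q: "sensing_strategy n Q" and budget: "within_budget n m \<mu> Q" and S: "S \<subseteq> {1..n}"
  shows "(\<Sum>i\<in>{1..n}. \<integral>\<^sup>+D. (\<Sum>j. sensing_cost (signal \<mu> S) (signal \<mu> (sym_diff S {i})) (snd (D j)))
      \<partial>data_law n (signal \<mu> S) Q) \<le> ennreal (\<mu>\<^sup>2 / 2) * ennreal m"
proof -
  let ?P = "data_law n (signal \<mu> S) Q"
  let ?c = "\<lambda>i. sensing_cost (signal \<mu> S) (signal \<mu> (sym_diff S {i}))"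
  interpret P: prob_space ?P by (rule prob_space_data_law[OF Q])
  have [measurable]: "(\<lambda>D. ?c i (snd (D j))) \<in> borel_measurable ?P" for i j
    by (rule measurable_data_action[OF Q measurable_sensing_cost])
  have "(\<Sum>i\<in>{1..n}. \<integral>\<^sup>+D. (\<Sum>j. ?c i (snd (D j))) \<partial>?P)
      = (\<integral>\<^sup>+D. (\<Sum>i\<in>{1..n}. \<Sum>j. ?c i (snd (D j))) \<partial>?P)"
    by (rule nn_integral_sum[symmetric]) measurable
  also have "\<dots> = (\<integral>\<^sup>+D. (\<Sum>j. \<Sum>i\<in>{1..n}. ?c i (snd (D j))) \<partial>?P)"
    by (intro nn_integral_cong suminf_sum[symmetric]) auto
  also have "\<dots> \<le> (\<integral>\<^sup>+D. ennreal (\<mu>\<^sup>2 / 2) * ennreal m \<partial>?P)"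
  proof (rule nn_integral_mono_AE)
    show "AE D in ?P. (\<Sum>j. \<Sum>i\<in>{1..n}. ?c i (snd (D j))) \<le> ennreal (\<mu>\<^sup>2 / 2) * ennreal m"
      using budget[unfolded within_budget_def, rule_format, OF S]
    proof eventually_elim
      case (elim D)
      have "(\<Sum>j. \<Sum>i\<in>{1..n}. ?c i (snd (D j)))
          \<le> (\<Sum>j. ennreal (\<mu>\<^sup>2 / 2) * ennreal ((snd (snd (D j)))\<^sup>2))"
        by (intro suminf_le sum_sensing_cost_le) auto
      also have "\<dots> = ennreal (\<mu>\<^sup>2 / 2) * (\<Sum>j. ennreal ((snd (snd (D j)))\<^sup>2))"
        by simp
      also have "\<dots> \<le> ennreal (\<mu>\<^sup>2 / 2) * ennreal m"
        by (rule mult_left_mono[OF elim]) simp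
      finally show ?case .
    qed
  qed
  also have "\<dots> = ennreal (\<mu>\<^sup>2 / 2) * ennreal m"
    by (simp add: P.emeasure_space_1)
  finally show ?thesis .
qed

text \<open>For each \<open>i\<close> take the event that \<open>i\<close> is decided as under
  \<open>S\<close>: it fails only by an error under \<open>S\<close>, and under the flipped support
  it is itself an error. With one \<open>l\<close> for all coordinates, the event bounds add up and
  their costs are covered by the budget.\<close>

lemma coordinate_error_tradeoff:
  assumes proc: "adaptive_procedure n m \<mu> Q \<phi>" and S: "S \<subseteq> {1..n}" and "0 \<le> l" "0 \<le> m"
  shows "l * (real n - (\<Sum>i\<in>{1..n}. coordinate_error n \<mu> Q \<phi> S i))
    \<le> (exp l - 1) * (\<Sum>i\<in>{1..n}. coordinate_error n \<mu> Q \<phi> (sym_diff S {i}) i) + \<mu>\<^sup>2 * m / 2"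
proof -
  have Q: "sensing_strategy n Q" and budget: "within_budget n m \<mu> Q" and \<phi>: "support_estimator n \<phi>"
    using proc by (auto simp: adaptive_procedure_def)
  let ?P = "data_law n (signal \<mu> S) Q"
  let ?c = "\<lambda>i. sensing_cost (signal \<mu> S) (signal \<mu> (sym_diff S {i}))"
  interpret P: prob_space ?P by (rule prob_space_data_law[OF Q])
  have sp: "space ?P = space (data_space n)"
    by (rule sets_eq_imp_space_eq[OF sets_data_law[OF Q]])
  define K where "K i = (\<integral>\<^sup>+D. (\<Sum>j. ?c i (snd (D j))) \<partial>?P)" for i
  have sumK: "(\<Sum>i\<in>{1..n}. K i) \<le> ennreal (\<mu>\<^sup>2 * m / 2)"
    using sum_sensing_cost_budget[OF Q budget S] \<open>0 \<le> m\<close>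
    unfolding K_def by (simp add: ennreal_mult[symmetric])
  \<comment> \<open>The event bound takes a real cost, so each \<open>K i\<close> has to be
    finite.\<close>
  have K_fin: "K i < \<top>" if "i \<in> {1..n}" for i
  proof -
    have "K i \<le> (\<Sum>i\<in>{1..n}. K i)" using that by (intro member_le_sum) auto
    then show ?thesis using sumK by (meson ennreal_less_top le_less_trans)
  qed
  have K_eq: "ennreal (enn2real (K i)) = K i" if "i \<in> {1..n}" for i
    using K_fin[OF that] by simp
  have "ennreal (\<Sum>i\<in>{1..n}. enn2real (K i)) = (\<Sum>i\<in>{1..n}. ennreal (enn2real (K i)))"
    by (rule sum_ennreal[symmetric]) simp
  also have "\<dots> = (\<Sum>i\<in>{1..n}. K i)"
    by (rule sum.cong[OF refl K_eq])
  finally have "ennreal (\<Sum>i\<in>{1..n}. enn2real (K i)) = (\<Sum>i\<in>{1..n}. K i)" .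
  with sumK have "ennreal (\<Sum>i\<in>{1..n}. enn2real (K i)) \<le> ennreal (\<mu>\<^sup>2 * m / 2)" by simp
  then have sumK': "(\<Sum>i\<in>{1..n}. enn2real (K i)) \<le> \<mu>\<^sup>2 * m / 2"
    using \<open>0 \<le> m\<close> by (subst (asm) ennreal_le_iff) auto
  have one: "l * (1 - coordinate_error n \<mu> Q \<phi> S i)
      \<le> (exp l - 1) * coordinate_error n \<mu> Q \<phi> (sym_diff S {i}) i + enn2real (K i)"
    if i: "i \<in> {1..n}" for i
  proof -
    let ?A = "{D \<in> space (data_space n). (i \<in> \<phi> D) = (i \<in> S)}"
    have A: "?A \<in> sets (data_space n)" by (rule sets_coordinate_event[OF \<phi>])
    have "l * measure ?P ?A
        \<le> (exp l - 1) * measure (data_law n (signal \<mu> (sym_diff S {i})) Q) ?A + enn2real (K i)"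
      by (rule data_law_event_bound[OF Q A]) (use \<open>0 \<le> l\<close> K_eq[OF i] in \<open>auto simp: K_def\<close>)
    moreover have "measure ?P ?A = 1 - coordinate_error n \<mu> Q \<phi> S i"
    proof -
      have "space ?P - ?A = {D \<in> space (data_space n). (i \<in> \<phi> D) \<noteq> (i \<in> S)}"
        by (auto simp: sp)
      then show ?thesis
        using P.prob_compl[of ?A] A by (simp add: coordinate_error_def sets_data_law[OF Q])
    qed
    moreover have "measure (data_law n (signal \<mu> (sym_diff S {i})) Q) ?A
        = coordinate_error n \<mu> Q \<phi> (sym_diff S {i}) i"
      unfolding coordinate_error_def by (rule arg_cong[where f="measure _"]) auto
    ultimately show ?thesis by simp
  qed
  have "l * (real n - (\<Sum>i\<in>{1..n}. coordinate_error n \<mu> Q \<phi> S i))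
      = (\<Sum>i\<in>{1..n}. l * (1 - coordinate_error n \<mu> Q \<phi> S i))"
    by (simp add: sum_distrib_left[symmetric] sum_subtractf)
  also have "\<dots> \<le> (\<Sum>i\<in>{1..n}. (exp l - 1) * coordinate_error n \<mu> Q \<phi> (sym_diff S {i}) i + enn2real (K i))"
    by (intro sum_mono one)
  also have "\<dots> \<le> (exp l - 1) * (\<Sum>i\<in>{1..n}. coordinate_error n \<mu> Q \<phi> (sym_diff S {i}) i) + \<mu>\<^sup>2 * m / 2"
    using sumK' by (simp add: sum.distrib sum_distrib_left)
  finally show ?thesis .
qed

section \<open>Double counting over supports of fixed size\<close>

definition subsets_of_card :: "'a set \<Rightarrow> nat \<Rightarrow> 'a set set" where
  "subsets_of_card U k = {S. S \<subseteq> U \<and> card S = k}"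

lemma finite_subsets_of_card: "finite U \<Longrightarrow> finite (subsets_of_card U k)"
  by (simp add: subsets_of_card_def)

text \<open>The map from (S, i) to (\<open>insert i S\<close>, i) is a bijection from pairs with i
  outside S to pairs with i in the larger set.\<close>

lemma sum_insert_subsets_of_card:
  fixes f :: "'a set \<Rightarrow> 'a \<Rightarrow> 'b::comm_monoid_add"
  assumes U: "finite U"
  shows "(\<Sum>S\<in>subsets_of_card U k. \<Sum>i\<in>U - S. f (insert i S) i)
    = (\<Sum>T\<in>subsets_of_card U (Suc k). \<Sum>i\<in>T. f T i)"
proof -
  have fin: "finite S" if "S \<in> subsets_of_card U j" for S j
    using that U by (auto simp: subsets_of_card_def intro: finite_subset)
  have "(\<Sum>(S, i)\<in>(SIGMA S:subsets_of_card U k. U - S). f (insert i S) i)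
      = (\<Sum>(T, i)\<in>(SIGMA T:subsets_of_card U (Suc k). T). f T i)"
    by (rule sum.reindex_bij_witness[where i="\<lambda>(T, i). (T - {i}, i)" and j="\<lambda>(S, i). (insert i S, i)"])
      (auto simp: subsets_of_card_def insert_absorb finite_subset[OF _ U])
  then show ?thesis
    using U fin by (simp add: sum.Sigma finite_subsets_of_card)
qed

lemma sum_remove_subsets_of_card:
  fixes f :: "'a set \<Rightarrow> 'a \<Rightarrow> 'b::comm_monoid_add"
  assumes U: "finite U"
  shows "(\<Sum>S\<in>subsets_of_card U (Suc k). \<Sum>i\<in>S. f (S - {i}) i)
    = (\<Sum>T\<in>subsets_of_card U k. \<Sum>i\<in>U - T. f T i)"
  unfolding sum_insert_subsets_of_card[OF U, of "\<lambda>T i. f (T - {i}) i", symmetric]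
  by (intro sum.cong) auto

text \<open>The bijection with summand 1 gives the ratio of consecutive binomial
  coefficients.\<close>

lemma card_subsets_of_card_Suc:
  assumes U: "finite U"
  shows "Suc k * card (subsets_of_card U (Suc k)) = (card U - k) * card (subsets_of_card U k)"
proof -
  have "(\<Sum>S\<in>subsets_of_card U k. \<Sum>i\<in>U - S. 1::nat) = (\<Sum>S\<in>subsets_of_card U k. card U - k)"
    by (rule sum.cong) (auto simp: subsets_of_card_def card_Diff_subset finite_subset[OF _ U])
  moreover have "(\<Sum>S\<in>subsets_of_card U (Suc k). \<Sum>i\<in>S. 1::nat) = (\<Sum>S\<in>subsets_of_card U (Suc k). Suc k)"
    by (rule sum.cong) (auto simp: subsets_of_card_def)
  ultimately show ?thesis
    using sum_insert_subsets_of_card[OF U, of "\<lambda>_ _. 1::nat" k] by (simp add: mult.commute)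
qed

section \<open>The lower bound for a fixed n\<close>

text \<open>Averages the tradeoff over all supports of size \<open>s\<close>. In the constant 3, a 1
  comes from the errors under flipped supports and a 2 from the correction
  \<open>l * \<epsilon>\<close>, both after division by \<open>n\<close>.\<close>

lemma signal_strength_bound:
  assumes proc: "adaptive_procedure n m \<mu> Q \<phi>" and n: "1 \<le> n" and m: "0 < m"
    and s: "1 \<le> s" "2 * s \<le> n" and \<epsilon>: "0 < \<epsilon>" "\<epsilon> \<le> 1"
    and err: "\<And>S. S \<in> support_class n s \<Longrightarrow> expected_error n \<mu> Q \<phi> S \<le> \<epsilon>"
  shows "- ln \<epsilon> - 3 \<le> m * \<mu>\<^sup>2 / (2 * real n) - ln (real s)"
proof -
  have Q: "sensing_strategy n Q" and \<phi>: "support_estimator n \<phi>"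
    using proc by (auto simp: adaptive_procedure_def)
  let ?U = "{1..n}" and ?C = "subsets_of_card {1..n}"
  define p where "p = coordinate_error n \<mu> Q \<phi>"
  have p0: "0 \<le> p S i" for S i by (simp add: p_def coordinate_error_def)
  have err': "(\<Sum>i\<in>?U. p S i) \<le> \<epsilon>" if "S \<in> ?C k" "k \<in> {s, s + 1, s - 1}" for S k
    using err[of S] that expected_error_eq_sum[OF Q \<phi>, of S \<mu>]
    by (auto simp: p_def subsets_of_card_def support_class_def)
  \<comment> \<open>Here \<open>r\<close> is \<open>s - 1\<close>; as \<open>s\<close> is positive,
    the truncated subtraction in \<open>support_class\<close> is exact.\<close>
  obtain r where r: "s = Suc r" using s by (cases s) auto
  \<comment> \<open>With this \<open>l\<close> the factor \<open>exp l\<close> just offsets an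
    average flipped error of order \<open>\<epsilon> / s\<close>, leaving at most 1 per
    coordinate.\<close>
  define l where "l = ln (real s / \<epsilon>)"
  have exp_l: "exp l = real s / \<epsilon>" using s \<epsilon> by (simp add: l_def)
  have l0: "0 \<le> l" using s \<epsilon> by (simp add: l_def field_simps)
  define N where "N = real (card (?C s))"
  have "0 < card (?C s)"
    using s by (simp add: subsets_of_card_def n_subsets)
  then have N0: "0 < N" by (simp add: N_def)

  \<comment> \<open>Summing over all supports of size \<open>s\<close> turns the errors under the flipped supports into
    errors under supports of size \<open>s + 1\<close> and \<open>s - 1\<close>.\<close>
  have ins: "(\<Sum>S\<in>?C s. \<Sum>i\<in>?U - S. p (insert i S) i) \<le> real (card (?C (Suc s))) * \<epsilon>"
  proof -
    have "(\<Sum>S\<in>?C s. \<Sum>i\<in>?U - S. p (insert i S) i) = (\<Sum>T\<in>?C (Suc s). \<Sum>i\<in>T. p T i)"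
      by (rule sum_insert_subsets_of_card) simp
    also have "\<dots> \<le> (\<Sum>T\<in>?C (Suc s). \<epsilon>)"
    proof (rule sum_mono)
      fix T assume T: "T \<in> ?C (Suc s)"
      then have "(\<Sum>i\<in>T. p T i) \<le> (\<Sum>i\<in>?U. p T i)"
        by (intro sum_mono2) (auto simp: subsets_of_card_def p0)
      also have "\<dots> \<le> \<epsilon>" using T by (intro err'[of _ "Suc s"]) auto
      finally show "(\<Sum>i\<in>T. p T i) \<le> \<epsilon>" .
    qed
    finally show ?thesis by simp
  qed
  have rem: "(\<Sum>S\<in>?C s. \<Sum>i\<in>S. p (S - {i}) i) \<le> real (card (?C r)) * \<epsilon>"
  proof -
    have "(\<Sum>S\<in>?C s. \<Sum>i\<in>S. p (S - {i}) i) = (\<Sum>T\<in>?C r. \<Sum>i\<in>?U - T. p T i)"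
      unfolding r by (rule sum_remove_subsets_of_card) simp
    also have "\<dots> \<le> (\<Sum>T\<in>?C r. \<epsilon>)"
    proof (rule sum_mono)
      fix T assume T: "T \<in> ?C r"
      have "(\<Sum>i\<in>?U - T. p T i) \<le> (\<Sum>i\<in>?U. p T i)"
        by (intro sum_mono2) (auto simp: p0)
      also have "\<dots> \<le> \<epsilon>" using T r by (intro err'[of _ r]) auto
      finally show "(\<Sum>i\<in>?U - T. p T i) \<le> \<epsilon>" .
    qed
    finally show ?thesis by simp
  qed
  have split: "(\<Sum>i\<in>?U. p (sym_diff S {i}) i) = (\<Sum>i\<in>?U - S. p (insert i S) i) + (\<Sum>i\<in>S. p (S - {i}) i)"
    if "S \<in> ?C s" for S
  proof -
    have SU: "S \<subseteq> ?U" using that by (simp add: subsets_of_card_def)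
    have "(\<Sum>i\<in>?U. p (sym_diff S {i}) i)
        = (\<Sum>i\<in>?U - S. p (sym_diff S {i}) i) + (\<Sum>i\<in>S. p (sym_diff S {i}) i)"
      by (rule sum.subset_diff[OF SU]) simp
    also have "(\<Sum>i\<in>?U - S. p (sym_diff S {i}) i) = (\<Sum>i\<in>?U - S. p (insert i S) i)"
      by (intro sum.cong refl arg_cong2[where f=p]) auto
    also have "(\<Sum>i\<in>S. p (sym_diff S {i}) i) = (\<Sum>i\<in>S. p (S - {i}) i)"
      by (intro sum.cong refl arg_cong2[where f=p]) auto
    finally show ?thesis .
  qed
  have flips: "exp l * (\<Sum>S\<in>?C s. \<Sum>i\<in>?U. p (sym_diff S {i}) i) \<le> real n * N"
  proof -
    have "(\<Sum>S\<in>?C s. \<Sum>i\<in>?U. p (sym_diff S {i}) i)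
        = (\<Sum>S\<in>?C s. (\<Sum>i\<in>?U - S. p (insert i S) i) + (\<Sum>i\<in>S. p (S - {i}) i))"
      by (rule sum.cong[OF refl split])
    also have "\<dots> \<le> real (card (?C (Suc s))) * \<epsilon> + real (card (?C r)) * \<epsilon>"
      unfolding sum.distrib by (rule add_mono[OF ins rem])
    finally have "exp l * (\<Sum>S\<in>?C s. \<Sum>i\<in>?U. p (sym_diff S {i}) i)
        \<le> exp l * (real (card (?C (Suc s))) * \<epsilon> + real (card (?C r)) * \<epsilon>)"
      by (rule mult_left_mono) simp
    also have "\<dots> = real s * real (card (?C (Suc s))) + real s * real (card (?C r))"
      using \<epsilon> by (simp add: exp_l field_simps)
    \<comment> \<open>\<open>card (?C (Suc s))\<close> is (n - s) / (s + 1) times \<open>N\<close>,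
      and s / (s + 1) is at most 1.\<close>
    also have "real s * real (card (?C (Suc s))) \<le> (real n - real s) * N"
    proof -
      have "real (Suc s) * real (card (?C (Suc s))) = (real n - real s) * N"
        using arg_cong[OF card_subsets_of_card_Suc[of ?U s], of real] s
        by (simp add: N_def of_nat_diff algebra_simps)
      then show ?thesis by (simp add: algebra_simps)
    qed
    \<comment> \<open>Binomial coefficients increase below the middle: \<open>2 * s \<le> n\<close>
      gives \<open>Suc r \<le> n - r\<close>.\<close>
    also have "real s * real (card (?C r)) \<le> real s * N"
    proof -
      have "Suc r * card (?C s) = (n - r) * card (?C r)"
        using card_subsets_of_card_Suc[of ?U r] by (simp add: r)
      moreover have "Suc r * card (?C r) \<le> (n - r) * card (?C r)"
        using s r by (intro mult_le_mono1) simp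
      ultimately have "Suc r * card (?C r) \<le> Suc r * card (?C s)" by (simp only:)
      then have "card (?C r) \<le> card (?C s)" by (simp only: Suc_mult_le_cancel1)
      then show ?thesis using r by (simp add: N_def)
    qed
    finally show ?thesis by (simp add: algebra_simps)
  qed
  have "(\<Sum>S\<in>?C s. l * (real n - \<epsilon>)) \<le> (\<Sum>S\<in>?C s. exp l * (\<Sum>i\<in>?U. p (sym_diff S {i}) i) + \<mu>\<^sup>2 * m / 2)"
  proof (rule sum_mono)
    fix S assume S: "S \<in> ?C s"
    have "l * (real n - \<epsilon>) \<le> l * (real n - (\<Sum>i\<in>?U. p S i))"
      using err'[OF S] l0 by (intro mult_left_mono) auto
    also have "\<dots> \<le> (exp l - 1) * (\<Sum>i\<in>?U. p (sym_diff S {i}) i) + \<mu>\<^sup>2 * m / 2"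
      unfolding p_def by (rule coordinate_error_tradeoff[OF proc]) (use S l0 m in \<open>auto simp: subsets_of_card_def\<close>)
    also have "(exp l - 1) * (\<Sum>i\<in>?U. p (sym_diff S {i}) i) \<le> exp l * (\<Sum>i\<in>?U. p (sym_diff S {i}) i)"
      by (intro mult_right_mono sum_nonneg) (auto simp: p0)
    finally show "l * (real n - \<epsilon>) \<le> exp l * (\<Sum>i\<in>?U. p (sym_diff S {i}) i) + \<mu>\<^sup>2 * m / 2" by simp
  qed
  also have "\<dots> = exp l * (\<Sum>S\<in>?C s. \<Sum>i\<in>?U. p (sym_diff S {i}) i) + N * (\<mu>\<^sup>2 * m / 2)"
    by (simp add: sum.distrib sum_distrib_left N_def)
  also have "\<dots> \<le> N * (real n + \<mu>\<^sup>2 * m / 2)"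
    using flips by (simp add: algebra_simps)
  finally have "N * (l * (real n - \<epsilon>)) \<le> N * (real n + \<mu>\<^sup>2 * m / 2)"
    by (simp add: N_def)
  then have "l * (real n - \<epsilon>) \<le> real n + \<mu>\<^sup>2 * m / 2"
    using N0 by simp
  \<comment> \<open>The two parts of \<open>l * \<epsilon>\<close> are at most \<open>s\<close> and
    1, since ln y <= y; each is at most \<open>n\<close>.\<close>
  moreover have "l * \<epsilon> \<le> 2 * real n"
  proof -
    have "l * \<epsilon> = \<epsilon> * ln (real s) + \<epsilon> * ln (1 / \<epsilon>)"
      using s \<epsilon> by (simp add: l_def ln_div algebra_simps)
    also have "\<epsilon> * ln (real s) \<le> 1 * real s"
      using \<epsilon> s ln_bound[of "real s"] by (intro mult_mono) auto
    also have "\<epsilon> * ln (1 / \<epsilon>) \<le> \<epsilon> * (1 / \<epsilon>)"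
      using \<epsilon> ln_bound[of "1 / \<epsilon>"] by (intro mult_left_mono) auto
    finally show ?thesis using s n \<epsilon> by simp
  qed
  ultimately have "l * real n \<le> (3 + m * \<mu>\<^sup>2 / (2 * real n)) * real n"
    using n by (simp add: algebra_simps)
  then have "l \<le> 3 + m * \<mu>\<^sup>2 / (2 * real n)"
    using n by simp
  then show ?thesis
    using s \<epsilon> by (simp add: l_def ln_div)
qed

section \<open>Passage to the limit\<close>

theorem corollary4p1:
  fixes s :: "nat \<Rightarrow> nat" and m \<mu> :: "nat \<Rightarrow> real"
    and Q :: "nat \<Rightarrow> strategy" and \<phi> :: "nat \<Rightarrow> (nat \<Rightarrow> obs) \<Rightarrow> nat set"
  assumes "\<And>n. n \<ge> 1 \<Longrightarrow> s n \<ge> 1"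
    and "\<And>n. n \<ge> 1 \<Longrightarrow> m n > 0"
    and "\<And>n. n \<ge> 1 \<Longrightarrow> \<mu> n > 0"
    and "(\<lambda>n. real (s n)) \<in> o(\<lambda>n. real n)"
    and "\<And>n. n \<ge> 1 \<Longrightarrow> adaptive_procedure n (m n) (\<mu> n) (Q n) (\<phi> n)"
    and "(\<lambda>n. Max (expected_error n (\<mu> n) (Q n) (\<phi> n) ` support_class n (s n)))
           \<longlonglongrightarrow> 0"
  shows "\<exists>\<omega> :: nat \<Rightarrow> real. filterlim \<omega> at_top sequentially \<and>
    (\<forall>n\<ge>1. \<forall>S \<subseteq> {1..n}. S \<noteq> {} \<longrightarrow>
       x_min n (signal (\<mu> n) S) \<ge> sqrt (2 * (real n / m n) * (ln (real (s n)) + \<omega> n)))"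
proof (intro exI conjI allI impI)
  \<comment> \<open>Chosen so that the claimed inequality is an equality for every
    \<open>n \<ge> 1\<close>; what remains is the divergence of \<open>\<omega>\<close>.\<close>
  define \<omega> where "\<omega> n = m n * (\<mu> n)\<^sup>2 / (2 * real n) - ln (real (s n))" for n
  define err where "err n = Max (expected_error n (\<mu> n) (Q n) (\<phi> n) ` support_class n (s n))" for n
  \<comment> \<open>The second summand keeps \<open>\<epsilon> n\<close> positive when the error
    vanishes. The absolute value also covers small \<open>n\<close> with an empty class, where
    \<open>Max\<close> is unspecified.\<close>
  define \<epsilon> where "\<epsilon> n = \<bar>err n\<bar> + 1 / real (Suc n)" for n
  have \<epsilon>_pos: "0 < \<epsilon> n" for n by (simp add: \<epsilon>_def add_nonneg_pos)
  have "\<epsilon> \<longlonglongrightarrow> \<bar>0\<bar> + 0"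
    unfolding \<epsilon>_def using assms(6) by (intro tendsto_add tendsto_rabs LIMSEQ_inverse_real_of_nat[unfolded inverse_eq_divide]) (simp add: err_def)
  then have \<epsilon>_lim: "\<epsilon> \<longlonglongrightarrow> 0" by simp
  have "filterlim \<epsilon> (at_right 0) sequentially"
    using \<epsilon>_lim \<epsilon>_pos by (simp add: filterlim_at less_imp_neq[symmetric])
  then have "filterlim (\<lambda>n. ln (\<epsilon> n)) at_bot sequentially"
    by (rule filterlim_compose[OF ln_at_0])
  then have "filterlim (\<lambda>n. - ln (\<epsilon> n)) at_top sequentially"
    by (simp add: filterlim_uminus_at_top)
  then have lim: "filterlim (\<lambda>n. - 3 + - ln (\<epsilon> n)) at_top sequentially"
    by (rule filterlim_tendsto_add_at_top[OF tendsto_const])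
  \<comment> \<open>The constant 1/2 in s = o(n) gives \<open>2 * s n \<le> n\<close>
    eventually.\<close>
  have "\<forall>\<^sub>F n in sequentially. norm (real (s n)) \<le> 1 / 2 * norm (real n)"
    by (rule landau_o.smallD[OF assms(4)]) simp
  moreover have "\<forall>\<^sub>F n in sequentially. \<epsilon> n < 1"
    by (rule order_tendstoD[OF \<epsilon>_lim]) simp
  ultimately have "\<forall>\<^sub>F n in sequentially. - 3 + - ln (\<epsilon> n) \<le> \<omega> n"
    using eventually_ge_at_top[of 1]
  proof eventually_elim
    case (elim n)
    have "expected_error n (\<mu> n) (Q n) (\<phi> n) S \<le> \<epsilon> n" if "S \<in> support_class n (s n)" for S
    proof -
      have "finite (support_class n (s n))" by (simp add: support_class_def)
      then have "expected_error n (\<mu> n) (Q n) (\<phi> n) S \<le> err n"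
        unfolding err_def using that by (intro Max_ge) auto
      also have "\<dots> \<le> \<epsilon> n" by (simp add: \<epsilon>_def add_increasing2)
      finally show ?thesis .
    qed
    from signal_strength_bound[OF assms(5)[OF elim(3)] elim(3) assms(2)[OF elim(3)]
        assms(1)[OF elim(3)] _ \<epsilon>_pos _ this]
    show ?case using elim by (simp add: \<omega>_def)
  qed
  with lim show "filterlim \<omega> at_top sequentially"
    by (rule filterlim_at_top_mono)
  fix n :: nat and S assume n: "1 \<le> n" and S: "S \<subseteq> {1..n}" "S \<noteq> {}"
  have "2 * (real n / m n) * (ln (real (s n)) + \<omega> n) = (\<mu> n)\<^sup>2"
    using n assms(2)[OF n] by (simp add: \<omega>_def)
  then show "x_min n (signal (\<mu> n) S) \<ge> sqrt (2 * (real n / m n) * (ln (real (s n)) + \<omega> n))"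
    using x_min_signal[OF assms(3)[OF n] S] assms(3)[OF n] by simp
qed

end
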